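(* Let $\mathcal{H}\subseteq E^{[\infty]}$ be a strategic $(p^+)$-family of block sequences and let $\mathbb{A}\subseteq \mathbb{R}\times E^{[\infty]}$ be analytic. Then there are a nonempty perfect set $P\subseteq\mathbb{R}$ and an $X\in\mathcal{H}$ such that either (i) player I has a strategy $\sigma$ in $F[X]$ such that $P\times[\sigma]\subseteq(\mathbb{R}\times E^{[\infty]})\setminus\mathbb{A}$, or (ii) for every $t\in P$, player II has a strategy in $G[X]$ for playing into $\mathbb{A}_t=\{Y\in E^{[\infty]}:(t,Y)\in\mathbb{A}\}$.
   Context: $F$ is a countable (possibly finite) field and $E$ a countably infinite-dimensional $F$-vector space with fixed basis $(e_n)$. $\mathrm{supp}(v)$ is the set of indices of nonzero coefficients of $v\neq0$. A block sequence is a sequence $(x_n)$ of nonzero vectors with $\max\mathrm{supp}(x_n)<\min\mathrm{supp}(x_{n+1})$. $E^{[\infty]}$ is the Polish space of infinite block sequences (subspace of $E^\omega$, $E$ discrete). $\langle X\rangle$ is the span; $Y\preceq X$ iff $\langle Y\rangle\subseteq\langle X\rangle$; $X/n$ is the tail of $X$ of vectors with support above $n$; $Y\preceq^*X$ iff $Y/n\preceq X$ for some $n$. A family is a nonempty $\mathcal{H}\subseteq E^{[\infty]}$ upward closed under $\preceq^*$; $\mathcal{H}\restriction X=\{Y\in\mathcal{H}:Y\preceq X\}$. $D\subseteq E$ is $\mathcal{H}$-dense below $X\in\mathcal{H}$ if for all $Y\in\mathcal{H}\restriction X$ there is $Z\in E^{[\infty]}$ with $Z\preceq Y$ and $\langle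 Z\rangle\subseteq D$. $\mathcal{H}$ is full if whenever $D$ is $\mathcal{H}$-dense below some $X\in\mathcal{H}$ there is $Z\in\mathcal{H}\restriction X$ with $\langle Z\rangle\subseteq D$. $\mathcal{H}$ is a $(p)$-family if every $\preceq$-decreasing sequence $(X_n)$ in $\mathcal{H}$ has some $X\in\mathcal{H}$ with $X\preceq^*X_n$ for all $n$; a $(p^+)$-family is a full $(p)$-family. $\mathcal{H}$ is strategic if whenever $X\in\mathcal{H}$ and $\alpha$ is a strategy for II in $G[X]$, some outcome of $\alpha$ lies in $\mathcal{H}$. Games: in $F[X]$, I plays $n_k\in\omega$ and II plays nonzero $y_k\in\langle X\rangle$ with $n_k<\min\mathrm{supp}(y_k)$; in $G[X]$, I plays $Y_k\preceq X$ in $E^{[\infty]}$ and II plays nonzero $y_k\in\langle Y_k\rangle$; in both II's moves must form a block sequence, which is the outcome. Strategies are functions from finite sequences of the opponent's moves to moves; "playing into (out of)" a set means all outcomes lie in (outside) it; $[\sigma]$ is the set of outcomes of plays where I follows $\sigma$. *)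

theory Defs
  imports "HOL-Analysis.Analysis" "HOL-Library.Countable"
begin

text \<open>The vector space E with basis (e_n): finitely supported functions nat => F.
  A vector v corresponds to the sum of v n * e_n.\<close>

definition supp :: "(nat \<Rightarrow> 'f::zero) \<Rightarrow> nat set" where
  "supp v = {n. v n \<noteq> 0}"

definition Evec :: "(nat \<Rightarrow> 'f::zero) set" where
  "Evec = {v. finite (supp v)}"

definition block_seq :: "(nat \<Rightarrow> nat \<Rightarrow> 'f::zero) \<Rightarrow> bool" where
  "block_seq X \<longleftrightarrow> (\<forall>n. X n \<in> Evec \<and> supp (X n) \<noteq> {}) \<and>
     (\<forall>n. Max (supp (X n)) < Min (supp (X (Suc n))))"

definition block_seqs :: "(nat \<Rightarrow> nat \<Rightarrow> 'f::zero) set" where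
  "block_seqs = {X. block_seq X}"

definition span_of :: "(nat \<Rightarrow> nat \<Rightarrow> 'f::field) \<Rightarrow> (nat \<Rightarrow> 'f) set" where
  "span_of X = {v. \<exists>c::nat \<Rightarrow> 'f. finite {n. c n \<noteq> 0} \<and>
      v = (\<lambda>i. \<Sum>n\<in>{n. c n \<noteq> 0}. c n * X n i)}"

definition bpreceq :: "(nat \<Rightarrow> nat \<Rightarrow> 'f::field) \<Rightarrow> (nat \<Rightarrow> nat \<Rightarrow> 'f) \<Rightarrow> bool" where
  "bpreceq Y X \<longleftrightarrow> span_of Y \<subseteq> span_of X"

definition tail_above :: "(nat \<Rightarrow> nat \<Rightarrow> 'f::zero) \<Rightarrow> nat \<Rightarrow> (nat \<Rightarrow> nat \<Rightarrow> 'f)" where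
  "tail_above X n = (\<lambda>k. X (k + (LEAST m. n < Min (supp (X m)))))"

definition bpreceq_star :: "(nat \<Rightarrow> nat \<Rightarrow> 'f::field) \<Rightarrow> (nat \<Rightarrow> nat \<Rightarrow> 'f) \<Rightarrow> bool" where
  "bpreceq_star Y X \<longleftrightarrow> (\<exists>n. bpreceq (tail_above Y n) X)"

definition is_family :: "(nat \<Rightarrow> nat \<Rightarrow> 'f::field) set \<Rightarrow> bool" where
  "is_family H \<longleftrightarrow> H \<noteq> {} \<and> H \<subseteq> block_seqs \<and>
     (\<forall>X\<in>H. \<forall>Y. block_seq Y \<and> bpreceq_star X Y \<longrightarrow> Y \<in> H)"

definition restr :: "(nat \<Rightarrow> nat \<Rightarrow> 'f::field) set \<Rightarrow> (nat \<Rightarrow> nat \<Rightarrow> 'f) \<Rightarrow> (nat \<Rightarrow> nat \<Rightarrow> 'f) set" where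
  "restr H X = {Y\<in>H. bpreceq Y X}"

definition dense_below :: "(nat \<Rightarrow> nat \<Rightarrow> 'f::field) set \<Rightarrow> (nat \<Rightarrow> 'f) set \<Rightarrow> (nat \<Rightarrow> nat \<Rightarrow> 'f) \<Rightarrow> bool" where
  "dense_below H D X \<longleftrightarrow> (\<forall>Y\<in>restr H X. \<exists>Z. block_seq Z \<and> bpreceq Z Y \<and> span_of Z \<subseteq> D)"

definition full_family :: "(nat \<Rightarrow> nat \<Rightarrow> 'f::field) set \<Rightarrow> bool" where
  "full_family H \<longleftrightarrow> (\<forall>D X. D \<subseteq> Evec \<and> X \<in> H \<and> dense_below H D X \<longrightarrow>
       (\<exists>Z\<in>restr H X. span_of Z \<subseteq> D))"

definition p_family :: "(nat \<Rightarrow> nat \<Rightarrow> 'f::field) set \<Rightarrow> bool" where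
  "p_family H \<longleftrightarrow> is_family H \<and>
     (\<forall>Xs. (\<forall>n. Xs n \<in> H) \<and> (\<forall>n. bpreceq (Xs (Suc n)) (Xs n)) \<longrightarrow>
        (\<exists>X\<in>H. \<forall>n. bpreceq_star X (Xs n)))"

definition p_plus_family :: "(nat \<Rightarrow> nat \<Rightarrow> 'f::field) set \<Rightarrow> bool" where
  "p_plus_family H \<longleftrightarrow> p_family H \<and> full_family H"

text \<open>The game G[X]. A strategy for II maps the finite sequence of I's moves
  (Y_0,...,Y_k) to II's answer y_k.  It is a strategy in G[X] if against every
  legal play of I (Y_k block sequences with Y_k below X) its answers are legal:
  y_k is a nonzero vector of span Y_k and the y_k form a block sequence.\<close>

definition G_play :: "((nat \<Rightarrow> nat \<Rightarrow> 'f) list \<Rightarrow> (nat \<Rightarrow> 'f)) \<Rightarrow> (nat \<Rightarrow> nat \<Rightarrow> nat \<Rightarrow> 'f) \<Rightarrow> (nat \<Rightarrow> nat \<Rightarrow> 'f)" where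
  "G_play \<alpha> Ys = (\<lambda>k. \<alpha> (map Ys [0..<Suc k]))"

definition G_legal_I :: "(nat \<Rightarrow> nat \<Rightarrow> 'f::field) \<Rightarrow> (nat \<Rightarrow> nat \<Rightarrow> nat \<Rightarrow> 'f) \<Rightarrow> bool" where
  "G_legal_I X Ys \<longleftrightarrow> (\<forall>k. block_seq (Ys k) \<and> bpreceq (Ys k) X)"

definition strategy_II_G :: "(nat \<Rightarrow> nat \<Rightarrow> 'f::field) \<Rightarrow> ((nat \<Rightarrow> nat \<Rightarrow> 'f) list \<Rightarrow> (nat \<Rightarrow> 'f)) \<Rightarrow> bool" where
  "strategy_II_G X \<alpha> \<longleftrightarrow> (\<forall>Ys. G_legal_I X Ys \<longrightarrow>
      (\<forall>k. G_play \<alpha> Ys k \<in> span_of (Ys k) \<and> supp (G_play \<alpha> Ys k) \<noteq> {}) \<and> block_seq (G_play \<alpha> Ys))"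

definition G_outcomes_II :: "(nat \<Rightarrow> nat \<Rightarrow> 'f::field) \<Rightarrow> ((nat \<Rightarrow> nat \<Rightarrow> 'f) list \<Rightarrow> (nat \<Rightarrow> 'f)) \<Rightarrow> (nat \<Rightarrow> nat \<Rightarrow> 'f) set" where
  "G_outcomes_II X \<alpha> = {G_play \<alpha> Ys | Ys. G_legal_I X Ys}"

definition strategic :: "(nat \<Rightarrow> nat \<Rightarrow> 'f::field) set \<Rightarrow> bool" where
  "strategic H \<longleftrightarrow> (\<forall>X\<in>H. \<forall>\<alpha>. strategy_II_G X \<alpha> \<longrightarrow> G_outcomes_II X \<alpha> \<inter> H \<noteq> {})"

text \<open>The game F[X]. A strategy for I maps the finite sequence of II's moves
  (y_0,...,y_{k-1}) to I's next move n_k (every natural number is a legal move).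
  [sigma] is the set of outcomes of plays where I follows sigma.\<close>

definition F_outcomes_I :: "(nat \<Rightarrow> nat \<Rightarrow> 'f::field) \<Rightarrow> ((nat \<Rightarrow> 'f) list \<Rightarrow> nat) \<Rightarrow> (nat \<Rightarrow> nat \<Rightarrow> 'f) set" where
  "F_outcomes_I X \<sigma> = {Y. block_seq Y \<and>
      (\<forall>k. Y k \<in> span_of X \<and> \<sigma> (map Y [0..<k]) < Min (supp (Y k)))}"

definition Einf_top :: "(nat \<Rightarrow> nat \<Rightarrow> 'f::zero) topology" where
  "Einf_top = subtopology (product_topology (\<lambda>_. discrete_topology Evec) UNIV) block_seqs"

definition baire_top :: "(nat \<Rightarrow> nat) topology" where
  "baire_top = product_topology (\<lambda>_. discrete_topology UNIV) UNIV"

definition analytic_in :: "'a topology \<Rightarrow> 'a set \<Rightarrow> bool" where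
  "analytic_in T A \<longleftrightarrow> A \<subseteq> topspace T \<and>
     (A = {} \<or> (\<exists>f. continuous_map baire_top T f \<and> range f = A))"

definition perfect_set :: "real set \<Rightarrow> bool" where
  "perfect_set P \<longleftrightarrow> closed P \<and> (\<forall>x\<in>P. x islimpt P)"

end

theory Submission
  imports Defs "HOL-Library.Function_Algebras"
begin

text \<open>Conditions are pairs of a compact perfect set Q of reals and a sequence X in H; fusion over a
  Cantor scheme combined with the (p)-property decides countably many questions at once.

  Write A as the image of a continuous f on Baire space. A position (ws, s) is bad near t if below
  no condition does I have a single strategy, valid for all parameters of a perfect set, that from
  ws on keeps the outcome out of the image of the basic open set of s. If the initial position is
  not everywhere bad, (i) holds. Otherwise, after fusion, II can move in G[X] from every bad
  position to a bad position with a longer s, and the resulting outcome lies in the section over t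
  by continuity of f. A further digit of s is only considered after as many moves of II as its
  size, so that I has to defend against finitely many digits at a time.

  The step from one bad position to the next is a game open for II. It is handled by a version of
  fullness for families of sets indexed by the reals: for sets G(b) depending on b in a closed way,
  a perfect set of parameters b and some Z in H satisfy either \<open>span Z \<subseteq> G(b)\<close> throughout, or that no
  span of a sequence below Z is contained in any G(b). This is where H being strategic is needed:
  II builds Z in the game G[X] while keeping alive a finite set of closed pieces of the parameter
  space, each of which is uncountable for all continuations and so can be split further.\<close>

section \<open>Block sequences and their spans\<close>

text \<open>The alternatives differ in uniformity: in (i) one strategy of I serves all of
  \<open>P\<close>, in (ii) the strategy of II may depend on the parameter. Fusion answers each
  question separately on finitely many pieces of the parameter set, so its answers are only local
  around each parameter. Two facts make them uniform. All properties that are decided are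
  hereditary, in the parameters and modulo finite in the sequence; and the moves of I are numbers of
  which a larger one is stronger, so over a compact set finitely many local strategies are replaced
  by their maximum. The notions \<open>live\<close> and \<open>bad\<close> are defined through
  neighbourhoods of the parameter and thus are open conditions, as the open game and the closed sets
  in the version of fullness require. Fullness yields either a span inside a set of vectors or a
  sequence all of whose subspaces meet the complement. It does not put a span on one side of an
  arbitrary partition, hence the different games for the two players. Also, I may play any block
  sequence in the game on \<open>X\<close>, whereas fusion speaks of sequences in \<open>H\<close>;
  fullness bridges this gap too.\<close>

interpretation vs: vector_space "\<lambda>(a::'f::field) (v::nat \<Rightarrow> 'f) i. a * v i"
  by unfold_locales (auto simp: fun_eq_iff algebra_simps)

text \<open>Unlike \<open>n < Min (supp v)\<close> this also makes sense for \<open>v = 0\<close>,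
  so the vectors above \<open>n\<close> form a subspace.\<close>

definition above :: "nat \<Rightarrow> (nat \<Rightarrow> 'f::zero) \<Rightarrow> bool" where
  "above n v \<longleftrightarrow> supp v \<subseteq> {n<..}"

lemma above_mono: "above n v \<Longrightarrow> m \<le> n \<Longrightarrow> above m v"
  by (auto simp: above_def)

lemma sum_fun_apply: "(\<Sum>n\<in>A. f n) i = (\<Sum>n\<in>A. f n i)"
  by (induct A rule: infinite_finite_induct) auto

lemma supp_eq_empty_iff: "supp v = {} \<longleftrightarrow> v = (0 :: nat \<Rightarrow> 'f::zero)"
  by (auto simp: supp_def fun_eq_iff)

lemma subspace_Evec: "vs.subspace (Evec :: (nat \<Rightarrow> 'f::field) set)"
proof (rule vs.subspaceI)
  fix x y :: "nat \<Rightarrow> 'f" assume "x \<in> Evec" "y \<in> Evec"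
  moreover have "supp (x + y) \<subseteq> supp x \<union> supp y" by (auto simp: supp_def)
  ultimately show "x + y \<in> Evec" by (auto simp: Evec_def intro: finite_subset)
next
  fix c :: 'f and x :: "nat \<Rightarrow> 'f" assume "x \<in> Evec"
  moreover have "supp (\<lambda>i. c * x i) \<subseteq> supp x" by (auto simp: supp_def)
  ultimately show "(\<lambda>i. c * x i) \<in> Evec" by (auto simp: Evec_def intro: finite_subset)
qed (auto simp: Evec_def supp_def)

lemma countable_Evec: "countable (Evec :: (nat \<Rightarrow> 'f::{zero,countable}) set)"
proof -
  define g :: "'f list \<Rightarrow> nat \<Rightarrow> 'f" where "g xs = (\<lambda>i. if i < length xs then xs ! i else 0)" for xs
  have "v \<in> range g" if "v \<in> Evec" for v
  proof -
    from that have "finite (supp v)" by (simp add: Evec_def)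
    then obtain n where n: "\<forall>i\<in>supp v. i < n" by (meson finite_nat_set_iff_bounded)
    have "v = g (map v [0..<n])"
      using n by (force simp: g_def supp_def fun_eq_iff)
    then show ?thesis by blast
  qed
  then have "Evec \<subseteq> range g" by blast
  then show ?thesis by (rule countable_subset) simp
qed

lemma span_of_eq_span: "span_of X = vs.span (range X)"
proof
  show "span_of X \<subseteq> vs.span (range X)"
  proof
    fix v assume "v \<in> span_of X"
    then obtain c where c: "v = (\<lambda>i. \<Sum>n\<in>{n. c n \<noteq> 0}. c n * X n i)" by (auto simp: span_of_def)
    have "v = (\<Sum>n\<in>{n. c n \<noteq> 0}. (\<lambda>i. c n * X n i))"
      unfolding c by (simp add: fun_eq_iff sum_fun_apply)
    also have "\<dots> \<in> vs.span (range X)"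
      by (intro vs.span_sum vs.span_scale vs.span_base) auto
    finally show "v \<in> vs.span (range X)" .
  qed
  \<comment> \<open>The index set in \<open>span_of\<close> depends on the coefficients. Two
    combinations are added after both are written over a common finite index set.\<close>
  have eq: "(\<Sum>n\<in>{n. c n \<noteq> 0}. c n * X n i) = (\<Sum>n\<in>A. c n * X n i)"
    if "finite A" "{n. c n \<noteq> 0} \<subseteq> A" for c A i
    using that by (intro sum.mono_neutral_left) auto
  show "vs.span (range X) \<subseteq> span_of X"
  proof (rule vs.span_minimal)
    show "range X \<subseteq> span_of X"
    proof safe
      fix n :: nat
      have s: "{k. (if k = n then 1 else (0::'a)) \<noteq> 0} = {n}" by auto
      show "X n \<in> span_of X"
        unfolding span_of_def mem_Collect_eq
        by (rule exI[of _ "\<lambda>k. if k = n then 1 else 0"]) (simp only: s, simp)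
    qed
    show "vs.subspace (span_of X)"
    proof (rule vs.subspaceI)
      show "0 \<in> span_of X" unfolding span_of_def mem_Collect_eq
        by (rule exI[of _ "\<lambda>k. 0"]) (auto simp: fun_eq_iff)
    next
      fix x y assume "x \<in> span_of X" "y \<in> span_of X"
      then obtain c d where c: "finite {n. c n \<noteq> 0}" "x = (\<lambda>i. \<Sum>n\<in>{n. c n \<noteq> 0}. c n * X n i)"
        and d: "finite {n. d n \<noteq> 0}" "y = (\<lambda>i. \<Sum>n\<in>{n. d n \<noteq> 0}. d n * X n i)"
        by (auto simp: span_of_def)
      let ?A = "{n. c n \<noteq> 0} \<union> {n. d n \<noteq> 0}"
      have s: "{n. c n + d n \<noteq> 0} \<subseteq> ?A" by auto
      have f: "finite ?A" using c d by simp
      show "x + y \<in> span_of X" unfolding span_of_def mem_Collect_eq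
      proof (intro exI conjI)
        show "finite {n. c n + d n \<noteq> 0}" using f s by (rule finite_subset[rotated])
        show "x + y = (\<lambda>i. \<Sum>n\<in>{n. c n + d n \<noteq> 0}. (c n + d n) * X n i)"
        proof
          fix i
          have "(\<Sum>n\<in>{n. c n + d n \<noteq> 0}. (c n + d n) * X n i) = (\<Sum>n\<in>?A. (c n + d n) * X n i)"
            using eq[of ?A "\<lambda>n. c n + d n"] f s by simp
          also have "\<dots> = (\<Sum>n\<in>?A. c n * X n i) + (\<Sum>n\<in>?A. d n * X n i)"
            by (simp add: sum.distrib algebra_simps)
          also have "\<dots> = x i + y i" unfolding c(2) d(2) using f by (subst (1 2) eq[of ?A]) auto
          finally show "(x + y) i = (\<Sum>n\<in>{n. c n + d n \<noteq> 0}. (c n + d n) * X n i)" by simp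
        qed
      qed
    next
      fix a x assume "x \<in> span_of X"
      then obtain c where c: "finite {n. c n \<noteq> 0}" "x = (\<lambda>i. \<Sum>n\<in>{n. c n \<noteq> 0}. c n * X n i)"
        by (auto simp: span_of_def)
      show "(\<lambda>i. a * x i) \<in> span_of X" unfolding span_of_def mem_Collect_eq
      proof (intro exI conjI)
        show "finite {n. a * c n \<noteq> 0}" by (rule finite_subset[OF _ c(1)]) auto
        show "(\<lambda>i. a * x i) = (\<lambda>i. \<Sum>n\<in>{n. a * c n \<noteq> 0}. (a * c n) * X n i)"
        proof
          fix i
          have "(\<Sum>n\<in>{n. a * c n \<noteq> 0}. (a * c n) * X n i) = (\<Sum>n\<in>{n. c n \<noteq> 0}. (a * c n) * X n i)"
            using eq[of "{n. c n \<noteq> 0}" "\<lambda>n. a * c n"] c(1) by auto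
          then show "a * x i = (\<Sum>n\<in>{n. a * c n \<noteq> 0}. (a * c n) * X n i)"
            unfolding c(2) by (simp add: sum_distrib_left mult.assoc)
        qed
      qed
    qed
  qed
qed

lemma bpreceq_iff: "bpreceq Y X \<longleftrightarrow> (\<forall>k. Y k \<in> span_of X)"
proof
  assume "bpreceq Y X"
  then show "\<forall>k. Y k \<in> span_of X"
    by (auto simp: bpreceq_def span_of_eq_span intro: vs.span_base)
next
  assume "\<forall>k. Y k \<in> span_of X"
  then have "range Y \<subseteq> vs.span (range X)" by (auto simp: span_of_eq_span)
  then show "bpreceq Y X" unfolding bpreceq_def span_of_eq_span
    by (rule vs.span_minimal) (rule vs.subspace_span)
qed

lemma bpreceq_refl: "bpreceq X X" and
  bpreceq_trans: "bpreceq X Y \<Longrightarrow> bpreceq Y Z \<Longrightarrow> bpreceq X Z"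
  by (auto simp: bpreceq_def)

lemma span_of_base: "X k \<in> span_of X"
  by (auto simp: span_of_eq_span intro: vs.span_base)

context
  fixes X :: "nat \<Rightarrow> nat \<Rightarrow> 'f::field"
  assumes X: "block_seq X"
begin

lemma block_seq_fin: "finite (supp (X n))" "supp (X n) \<noteq> {}"
  using X by (auto simp: block_seq_def Evec_def)

lemma block_seq_less:
  assumes "m < n" shows "Max (supp (X m)) < Min (supp (X n))"
  using assms
proof (induct n)
  case (Suc n)
  have a: "Max (supp (X n)) < Min (supp (X (Suc n)))" using X by (simp add: block_seq_def)
  show ?case
  proof (cases "m = n")
    case False
    then have "Max (supp (X m)) < Min (supp (X n))" using Suc by simp
    also have "\<dots> \<le> Max (supp (X n))" using block_seq_fin[of n] by (simp add: Min_le_iff)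
    finally show ?thesis using a by simp
  qed (use a in simp)
qed simp

text \<open>This guarantees that the \<open>LEAST\<close> in \<open>tail_above\<close>
  exists.\<close>

lemma block_seq_Min_ge: "n \<le> Min (supp (X n))"
proof (induct n)
  case (Suc n)
  have "Min (supp (X n)) \<le> Max (supp (X n))" using block_seq_fin[of n] by simp
  with Suc block_seq_less[of n "Suc n"] show ?case by simp
qed simp

lemma block_seq_disjoint_supp:
  assumes "m \<noteq> n" "i \<in> supp (X m)" shows "i \<notin> supp (X n)"
proof
  assume "i \<in> supp (X n)"
  then have "Min (supp (X m)) \<le> i" "i \<le> Max (supp (X m))" "Min (supp (X n)) \<le> i" "i \<le> Max (supp (X n))"
    using assms block_seq_fin by auto
  then show False using block_seq_less[of m n] block_seq_less[of n m] assms(1) by linarith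
qed

lemma span_of_subset_Evec: "span_of X \<subseteq> Evec"
  unfolding span_of_eq_span
  by (rule vs.span_minimal) (use X subspace_Evec in \<open>auto simp: block_seq_def\<close>)

lemma above_iff_Min: "v \<in> span_of X \<Longrightarrow> supp v \<noteq> {} \<Longrightarrow> above n v \<longleftrightarrow> n < Min (supp v)"
  using span_of_subset_Evec by (subst Min_gr_iff) (auto simp: Evec_def above_def)

lemma tail_above_Least: "n < Min (supp (X (LEAST m. n < Min (supp (X m)))))"
  by (rule LeastI[of _ "Suc n"]) (use block_seq_Min_ge[of "Suc n"] in simp)

lemma block_seq_tail_above: "block_seq (tail_above X n)"
  using X by (auto simp: block_seq_def tail_above_def)

lemma bpreceq_tail_above: "bpreceq (tail_above X n) X"
  by (auto simp: bpreceq_iff tail_above_def span_of_base)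

lemma above_tail_above: "above n (tail_above X n k)"
  unfolding above_def
proof
  fix i let ?m = "LEAST m. n < Min (supp (X m))"
  assume "i \<in> supp (tail_above X n k)"
  then have "Min (supp (X (k + ?m))) \<le> i" using block_seq_fin by (simp add: tail_above_def)
  moreover have "Min (supp (X ?m)) \<le> Min (supp (X (k + ?m)))"
  proof (cases "k = 0")
    case False
    then have "Max (supp (X ?m)) < Min (supp (X (k + ?m)))" by (intro block_seq_less) simp
    moreover have "Min (supp (X ?m)) \<le> Max (supp (X ?m))" using block_seq_fin by simp
    ultimately show ?thesis by simp
  qed simp
  ultimately show "i \<in> {n<..}" using tail_above_Least[of n] by simp
qed

lemma above_span_tail_above:
  assumes "v \<in> span_of (tail_above X n)" shows "above n v"
proof -
  have "vs.span (range (tail_above X n)) \<subseteq> {v. above n v}"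
  proof (rule vs.span_minimal)
    show "vs.subspace {v::nat \<Rightarrow> 'f. above n v}"
    proof (rule vs.subspaceI)
      fix x y :: "nat \<Rightarrow> 'f" assume "x \<in> {v. above n v}" "y \<in> {v. above n v}"
      moreover have "supp (x + y) \<subseteq> supp x \<union> supp y" by (auto simp: supp_def)
      ultimately show "x + y \<in> {v. above n v}" by (auto simp: above_def)
    next
      fix c and x :: "nat \<Rightarrow> 'f" assume "x \<in> {v. above n v}"
      then show "(\<lambda>i. c * x i) \<in> {v. above n v}" by (auto simp: supp_def above_def)
    qed (auto simp: supp_def above_def)
  qed (use above_tail_above in auto)
  with assms show ?thesis by (auto simp: span_of_eq_span)
qed

text \<open>Coefficients of the vectors before the tail are read off at the least index of their
  supports, where no other block contributes.\<close>
lemma in_span_tail_above: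
  assumes v: "v \<in> span_of X" and ab: "above n v"
  shows "v \<in> span_of (tail_above X n)"
proof -
  let ?m = "LEAST m. n < Min (supp (X m))"
  obtain c where c: "finite {n. c n \<noteq> 0}" "v = (\<lambda>i. \<Sum>n\<in>{n. c n \<noteq> 0}. c n * X n i)"
    using v by (auto simp: span_of_def)
  have z: "c k = 0" if "k < ?m" for k
  proof (rule ccontr)
    assume ck: "c k \<noteq> 0"
    let ?i = "Min (supp (X k))"
    have i: "?i \<in> supp (X k)" using block_seq_fin by simp
    have "?i \<le> n" using not_less_Least[OF that] by simp
    then have "v ?i = 0" using ab by (force simp: supp_def above_def)
    moreover have "v ?i = (\<Sum>j\<in>{n. c n \<noteq> 0}. if j = k then c k * X k ?i else 0)"
      unfolding c(2) using block_seq_disjoint_supp[OF _ i]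
      by (intro sum.cong) (auto simp: supp_def)
    ultimately show False using c(1) ck i by (auto simp: supp_def)
  qed
  have "v = (\<Sum>n\<in>{n. c n \<noteq> 0}. (\<lambda>i. c n * X n i))"
    unfolding c(2) by (simp add: fun_eq_iff sum_fun_apply)
  also have "\<dots> \<in> vs.span (range (tail_above X n))"
  proof (intro vs.span_sum vs.span_scale vs.span_base)
    fix k assume "k \<in> {n. c n \<noteq> 0}"
    then have "?m \<le> k" using z[of k] by (meson mem_Collect_eq not_le)
    then have "X k = tail_above X n (k - ?m)" by (simp add: tail_above_def)
    then show "X k \<in> range (tail_above X n)" by blast
  qed
  finally show ?thesis by (simp add: span_of_eq_span)
qed

text \<open>A threshold on vectors replaces the tail of a sequence. Thresholds combine by maxima,
  which gives transitivity at once.\<close>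

lemma bpreceq_star_iff:
  "bpreceq_star X Y \<longleftrightarrow> (\<exists>n. \<forall>v\<in>span_of X. above n v \<longrightarrow> v \<in> span_of Y)"
proof
  assume "bpreceq_star X Y"
  then show "\<exists>n. \<forall>v\<in>span_of X. above n v \<longrightarrow> v \<in> span_of Y"
    using in_span_tail_above unfolding bpreceq_star_def bpreceq_def by blast
next
  assume "\<exists>n. \<forall>v\<in>span_of X. above n v \<longrightarrow> v \<in> span_of Y"
  then obtain n where n: "\<forall>v\<in>span_of X. above n v \<longrightarrow> v \<in> span_of Y" by blast
  have "bpreceq (tail_above X n) Y"
    unfolding bpreceq_iff
  proof
    fix k
    have "tail_above X n k \<in> span_of X" by (simp add: tail_above_def span_of_base)
    then show "tail_above X n k \<in> span_of Y" using n above_tail_above by blast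
  qed
  then show "bpreceq_star X Y" by (auto simp: bpreceq_star_def)
qed

end

lemma bpreceq_imp_star: "block_seq X \<Longrightarrow> bpreceq X Y \<Longrightarrow> bpreceq_star X Y"
  by (auto simp: bpreceq_star_iff bpreceq_def)

lemma bpreceq_star_trans:
  assumes "block_seq X" "block_seq Y" "bpreceq_star X Y" "bpreceq_star Y Z"
  shows "bpreceq_star X Z"
proof -
  obtain n m where "\<forall>v\<in>span_of X. above n v \<longrightarrow> v \<in> span_of Y" "\<forall>v\<in>span_of Y. above m v \<longrightarrow> v \<in> span_of Z"
    using assms by (auto simp: bpreceq_star_iff)
  then have "\<forall>v\<in>span_of X. above (max n m) v \<longrightarrow> v \<in> span_of Z"
    by (meson above_mono max.cobounded1 max.cobounded2)
  then show ?thesis using assms by (auto simp: bpreceq_star_iff)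
qed

text \<open>The source of all heredity modulo finite: a statement about all \<open>Z\<close> below
  \<open>Y\<close> is applied to a tail of \<open>Z\<close>, and what it finds there also lies in
  the span of \<open>Z\<close>.\<close>

lemma bpreceq_star_tail:
  assumes "block_seq X" "block_seq Z" "bpreceq_star X Y" "bpreceq Z X"
  obtains n where "bpreceq (tail_above Z n) Y"
proof -
  have "bpreceq_star Z Y"
    using bpreceq_star_trans[OF assms(2,1) bpreceq_imp_star[OF assms(2,4)] assms(3)] .
  then show ?thesis using that by (auto simp: bpreceq_star_def)
qed

section \<open>Perfect sets and fusion\<close>

text \<open>Stronger than \<open>perfect_set\<close>: compactness gives nonempty nested
  intersections and finite subcovers.\<close>

definition perf :: "real set \<Rightarrow> bool" where
  "perf Q \<longleftrightarrow> compact Q \<and> Q \<noteq> {} \<and> (\<forall>x\<in>Q. x islimpt Q)"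

lemma perf_Icc: "a < b \<Longrightarrow> perf {a..b}"
  by (auto simp: perf_def islimpt_Icc)

lemma perf_imp_perfect_set: "perf P \<Longrightarrow> P \<noteq> {} \<and> perfect_set P"
  by (auto simp: perf_def perfect_set_def compact_imp_closed)

text \<open>A relatively open part of a perfect set has no isolated points but need not be closed;
  the closure only adds limit points.\<close>

lemma perf_closure_Int_open:
  assumes "perf Q" "open U" "Q \<inter> U \<noteq> {}"
  shows "perf (closure (Q \<inter> U))" "closure (Q \<inter> U) \<subseteq> Q"
proof -
  have cl: "closed Q" using assms by (simp add: perf_def compact_imp_closed)
  show sub: "closure (Q \<inter> U) \<subseteq> Q" using closure_minimal[OF _ cl, of "Q \<inter> U"] by auto
  have lim: "x islimpt (Q \<inter> U)" if "x \<in> Q \<inter> U" for x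
    using islimpt_Int_eventually[of x Q U] that assms eventually_at_topological
    by (force simp: perf_def)
  have "compact (closure (Q \<inter> U))"
    using assms sub by (metis closed_closure compact_Int_closed inf.absorb_iff2 perf_def)
  moreover have "x islimpt closure (Q \<inter> U)" if "x \<in> closure (Q \<inter> U)" for x
    using that lim[of x] islimpt_subset[OF _ closure_subset] unfolding closure_def by blast
  ultimately show "perf (closure (Q \<inter> U))" using assms(3) by (auto simp: perf_def)
qed

lemma perf_nbhd:
  assumes "perf Q" "open U" "t \<in> Q" "t \<in> U"
  obtains Q' where "perf Q'" "Q' \<subseteq> Q \<inter> U"
proof -
  obtain e where e: "e > 0" "cball t e \<subseteq> U" using assms(2,4) open_contains_cball by blast
  have sub: "closure (Q \<inter> ball t e) \<subseteq> U"
    using e closure_minimal[of "Q \<inter> ball t e" "cball t e"] ball_subset_cball by fastforce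
  have "Q \<inter> ball t e \<noteq> {}" using assms e by auto
  from perf_closure_Int_open[OF assms(1) open_ball this] sub show ?thesis
    using that by blast
qed

lemma perf_split:
  assumes "perf Q" "e > 0"
  obtains A B where "perf A" "perf B" "A \<subseteq> Q" "B \<subseteq> Q" "A \<inter> B = {}"
    "\<forall>x\<in>A. \<forall>y\<in>A. dist x y \<le> e" "\<forall>x\<in>B. \<forall>y\<in>B. dist x y \<le> e"
proof -
  obtain a where a: "a \<in> Q" using assms by (auto simp: perf_def)
  then have "a islimpt Q" using assms by (auto simp: perf_def)
  then obtain b where b: "b \<in> Q" "b \<noteq> a" unfolding islimpt_def by (metis UNIV_I open_UNIV)
  \<comment> \<open>Balls of radius \<open>d\<close> have diameter at most \<open>e\<close>, and
    those around \<open>a\<close> and \<open>b\<close> are disjoint because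
    \<open>2 * d < dist a b\<close>.\<close>
  define d where "d = min (e/2) (dist a b / 3)"
  have d: "d > 0" using assms b by (simp add: d_def)
  obtain A where A: "perf A" "A \<subseteq> Q \<inter> ball a d" using perf_nbhd[OF assms(1) open_ball a] d by (metis centre_in_ball)
  obtain B where B: "perf B" "B \<subseteq> Q \<inter> ball b d" using perf_nbhd[OF assms(1) open_ball b(1)] d by (metis centre_in_ball)
  have dj: "A \<inter> B = {}"
  proof (rule ccontr)
    assume "A \<inter> B \<noteq> {}"
    then obtain x where "dist a x < d" "dist b x < d" using A B by fastforce
    then have "dist a b < 2 * d" using dist_triangle2[of a b x] by linarith
    moreover have "3 * d \<le> dist a b" by (simp add: d_def)
    ultimately show False using d by linarith
  qed
  have diam: "\<forall>x\<in>C. \<forall>y\<in>C. dist x y \<le> e" if "C \<subseteq> ball c d" for C c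
  proof (intro ballI)
    fix x y assume "x \<in> C" "y \<in> C"
    then have "dist c x < d" "dist c y < d" using that by auto
    then have "dist x y < 2 * d" using dist_triangle3[of x y c] by linarith
    also have "\<dots> \<le> e" by (simp add: d_def min_def)
    finally show "dist x y \<le> e" by simp
  qed
  have "\<forall>x\<in>A. \<forall>y\<in>A. dist x y \<le> e" "\<forall>x\<in>B. \<forall>y\<in>B. dist x y \<le> e"
    using diam[of A a] diam[of B b] A B by simp_all
  with dj show ?thesis using A B by (intro that[of A B]) simp_all
qed

text \<open>Local bounds become one move of I that works for all parameters. Asking for all
  \<open>m\<ge>n\<close> allows the maximum over a finite subcover.\<close>

lemma compact_uniform_bound:
  fixes P :: "'a::topological_space set"
  assumes "compact P"
    and "\<And>t. t \<in> P \<Longrightarrow> \<exists>V n. open V \<and> t \<in> V \<and> (\<forall>u\<in>P \<inter> V. \<forall>m\<ge>n. \<Psi> u m)"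
  shows "\<exists>n::nat. \<forall>t\<in>P. \<forall>m\<ge>n. \<Psi> t m"
proof -
  obtain V n where V: "\<And>t. t \<in> P \<Longrightarrow> open (V t) \<and> t \<in> V t \<and> (\<forall>u\<in>P \<inter> V t. \<forall>m\<ge>n t. \<Psi> u m)"
    using assms(2) by metis
  have "P \<subseteq> (\<Union>t\<in>P. V t)" using V by blast
  then obtain D where D: "D \<subseteq> P" "finite D" "P \<subseteq> (\<Union>t\<in>D. V t)"
    using compactE_image[OF assms(1), of P V] V by metis
  show ?thesis
  proof (intro exI ballI allI impI)
    fix t m assume t: "t \<in> P" and m: "Max (insert 0 (n ` D)) \<le> m"
    then obtain u where u: "u \<in> D" "t \<in> V u" using D by blast
    then have "n u \<le> m" using m D(2) by simp
    then show "\<Psi> t m" using V[of u] u t D by blast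
  qed
qed

text \<open>A level is a finite set of nodes, without binary strings as indices; \<open>l n\<close>
  and \<open>r n\<close> give the children. Every node meets \<open>P\<close>, so the two disjoint
  children of a small node around \<open>t\<close> supply a point of \<open>P\<close> close to
  \<open>t\<close> and different from it. Distinct nodes of a level are disjoint compact sets, hence
  relatively open in \<open>P\<close>: this is the last claim, which turns answers on nodes into
  local answers.\<close>

lemma cantor_scheme:
  fixes U :: "nat \<Rightarrow> real set set"
  assumes U0: "U 0 = {K0}" and K0: "compact K0" "K0 \<noteq> {}"
    and US: "\<And>n. U (Suc n) = l n ` U n \<union> r n ` U n"
    and sub: "\<And>n K. K \<in> U n \<Longrightarrow> l n K \<subseteq> K" "\<And>n K. K \<in> U n \<Longrightarrow> r n K \<subseteq> K"
    and cpt: "\<And>n K. K \<in> U n \<Longrightarrow> compact (l n K)" "\<And>n K. K \<in> U n \<Longrightarrow> compact (r n K)"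
    and ne: "\<And>n K. K \<in> U n \<Longrightarrow> l n K \<noteq> {}" "\<And>n K. K \<in> U n \<Longrightarrow> r n K \<noteq> {}"
    and dj: "\<And>n K. K \<in> U n \<Longrightarrow> l n K \<inter> r n K = {}"
    and diam: "\<And>n K x y. K \<in> U (Suc n) \<Longrightarrow> x \<in> K \<Longrightarrow> y \<in> K \<Longrightarrow> dist x y \<le> 1 / Suc n"
  defines "P \<equiv> \<Inter>n. \<Union>(U n)"
  shows "perf P" and "P \<subseteq> K0"
    and "\<And>n t. t \<in> P \<Longrightarrow> \<exists>K\<in>U n. \<exists>V. open V \<and> t \<in> V \<and> P \<inter> V \<subseteq> K"
proof -
  have fin: "finite (U n)" for n by (induct n) (auto simp: U0 US)
  have K: "compact K \<and> K \<noteq> {}" if "K \<in> U n" for n K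
    using that by (induct n arbitrary: K) (use U0 K0 US cpt ne in auto)
  have cptU: "compact (\<Union>(U n))" for n using K fin by (auto intro: compact_Union)
  have step: "\<Union>(U (Suc n)) \<subseteq> \<Union>(U n)" for n using sub by (fastforce simp: US)
  then have anti: "\<Union>(U n) \<subseteq> \<Union>(U m)" if "m \<le> n" for m n using that by (rule lift_Suc_antimono_le)
  have desc: "\<exists>K'. K' \<in> U (n + k) \<and> K' \<subseteq> K" if "K \<in> U n" for n k K
  proof (induct k)
    case (Suc k)
    then obtain K' where "K' \<in> U (n + k)" "K' \<subseteq> K" by blast
    then have "l (n + k) K' \<in> U (n + Suc k)" "l (n + k) K' \<subseteq> K" using sub by (auto simp: US)
    then show ?case by blast
  qed (use that in auto)
  have meets: "K \<inter> P \<noteq> {}" if "K \<in> U n" for n K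
  proof -
    have "(\<Inter>m. K \<inter> \<Union>(U m)) \<noteq> {}"
    proof (rule compact_nest)
      show "compact (K \<inter> \<Union>(U m))" for m using K[OF that] cptU by (auto intro: compact_Int)
      show "K \<inter> \<Union>(U m) \<noteq> {}" for m
      proof -
        obtain K' where "K' \<in> U (n + m)" "K' \<subseteq> K" using desc[OF \<open>K \<in> U n\<close>] by blast
        then show ?thesis using K[of K' "n + m"] anti[of m "n + m"] by fastforce
      qed
      show "K \<inter> \<Union>(U k) \<subseteq> K \<inter> \<Union>(U m)" if "m \<le> k" for m k using anti[OF that] by blast
    qed
    then show ?thesis by (auto simp: P_def)
  qed
  have disj: "K \<inter> K' = {}" if "K \<in> U n" "K' \<in> U n" "K \<noteq> K'" for n K K'
    using that
  proof (induct n arbitrary: K K')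
    case (Suc n)
    obtain L L' where L: "L \<in> U n" "K = l n L \<or> K = r n L" "L' \<in> U n" "K' = l n L' \<or> K' = r n L'"
      using Suc.prems by (auto simp: US)
    show ?case
    proof (cases "L = L'")
      case False
      then have "L \<inter> L' = {}" using Suc.hyps L by blast
      moreover have "K \<subseteq> L" "K' \<subseteq> L'" using L sub[OF L(1)] sub[OF L(3)] by auto
      ultimately show ?thesis by blast
    qed (use L dj Suc.prems in blast)
  qed (simp add: U0)
  show "P \<subseteq> K0"
  proof
    fix x assume "x \<in> P"
    then have "x \<in> \<Union>(U 0)" unfolding P_def by blast
    then show "x \<in> K0" by (simp add: U0)
  qed
  have cptP: "compact P"
  proof -
    have "closed P" unfolding P_def using cptU by (auto intro: compact_imp_closed)
    then show ?thesis using K0(1) \<open>P \<subseteq> K0\<close> by (metis compact_Int_closed inf.absorb_iff2)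
  qed
  show loc: "\<exists>K\<in>U n. \<exists>V. open V \<and> t \<in> V \<and> P \<inter> V \<subseteq> K" if "t \<in> P" for n t
  proof -
    obtain K' where K': "K' \<in> U n" "t \<in> K'" using \<open>t \<in> P\<close> by (auto simp: P_def)
    let ?V = "- \<Union>(U n - {K'})"
    have "closed (\<Union>(U n - {K'}))"
      using K fin by (intro closed_Union) (auto intro: compact_imp_closed)
    moreover have "t \<in> ?V" using K' disj by blast
    moreover have "P \<inter> ?V \<subseteq> K'" by (auto simp: P_def)
    ultimately show ?thesis using K' by blast
  qed
  have "t islimpt P" if t: "t \<in> P" for t
    unfolding islimpt_approachable
  proof (intro allI impI)
    fix e :: real assume "0 < e"
    then obtain n where n: "1 / Suc n < e" using nat_approx_posE by blast
    obtain L where L: "L \<in> U (Suc n)" "t \<in> L" using loc[OF t, of "Suc n"] t by blast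
    then have "l (Suc n) L \<in> U (Suc (Suc n))" "r (Suc n) L \<in> U (Suc (Suc n))" by (auto simp: US)
    then have "l (Suc n) L \<inter> P \<noteq> {}" "r (Suc n) L \<inter> P \<noteq> {}" using meets by blast+
    then obtain y where y: "y \<in> P" "y \<in> L" "y \<noteq> t" using dj[OF L(1)] sub[OF L(1)] by blast
    then have "dist y t \<le> 1 / Suc n" using diam[OF L(1)] L(2) by blast
    then show "\<exists>x'\<in>P. x' \<noteq> t \<and> dist x' t < e" using y n by (intro bexI[of _ y]) auto
  qed
  moreover have "P \<noteq> {}" using meets[of K0 0] U0 by auto
  ultimately show "perf P" using cptP by (auto simp: perf_def)
qed

section \<open>Lower bounds in the family and the fusion theorem\<close>

locale strategic_p_plus =
  fixes H :: "(nat \<Rightarrow> nat \<Rightarrow> 'f::{field,countable}) set"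
  assumes strat: "strategic H" and pplus: "p_plus_family H"
begin

lemma H_block_seq: "X \<in> H \<Longrightarrow> block_seq X"
  using pplus by (auto simp: p_plus_family_def p_family_def is_family_def block_seqs_def)

lemma H_upward: "X \<in> H \<Longrightarrow> block_seq Y \<Longrightarrow> bpreceq_star X Y \<Longrightarrow> Y \<in> H"
  using pplus by (auto simp: p_plus_family_def p_family_def is_family_def)

lemma H_nonempty: "H \<noteq> {}"
  using pplus by (auto simp: p_plus_family_def p_family_def is_family_def)

lemma H_tail_above: "X \<in> H \<Longrightarrow> tail_above X n \<in> H"
  by (rule H_upward[of X])
    (auto simp: H_block_seq block_seq_tail_above bpreceq_star_iff intro!: exI[of _ n] in_span_tail_above)

lemma H_star_tail:
  assumes "X \<in> H" "bpreceq_star X Y"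
  obtains n where "tail_above X n \<in> H" "bpreceq (tail_above X n) Y"
  using assms H_tail_above by (auto simp: bpreceq_star_def)

text \<open>The (p)-property bounds the sequence only modulo finite; a tail of that bound lies truly
  below \<open>Xs 0\<close>.\<close>

lemma H_lower_bound:
  assumes "\<And>n. Xs n \<in> H" "\<And>n. bpreceq (Xs (Suc n)) (Xs n)"
  obtains X where "X \<in> H" "bpreceq X (Xs 0)" "\<And>n. bpreceq_star X (Xs n)"
proof -
  obtain Y where Y: "Y \<in> H" "\<And>n. bpreceq_star Y (Xs n)"
    using pplus assms unfolding p_plus_family_def p_family_def by blast
  then obtain k where k: "tail_above Y k \<in> H" "bpreceq (tail_above Y k) (Xs 0)"
    using H_star_tail by blast
  have "bpreceq_star (tail_above Y k) (Xs n)" for n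
    using bpreceq_star_trans[of "tail_above Y k" Y "Xs n"] Y k H_block_seq
    by (simp add: bpreceq_imp_star bpreceq_tail_above)
  with k that show ?thesis by blast
qed

text \<open>The pieces are treated in turn while the sequence shrinks; heredity keeps the answers
  already obtained.\<close>

lemma fusion_step:
  assumes her: "\<And>Q X Q' X'. K Q X \<Longrightarrow> Q' \<subseteq> Q \<Longrightarrow> X \<in> H \<Longrightarrow> X' \<in> H \<Longrightarrow> bpreceq_star X' X \<Longrightarrow> K Q' X'"
    and dense: "\<And>Q X. perf Q \<Longrightarrow> Q \<subseteq> Q0 \<Longrightarrow> X \<in> H \<Longrightarrow> bpreceq X X0 \<Longrightarrow>
        \<exists>Q' Y. perf Q' \<and> Q' \<subseteq> Q \<and> Y \<in> H \<and> bpreceq Y X \<and> K Q' Y"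
    and "finite U" "\<And>Q. Q \<in> U \<Longrightarrow> perf Q \<and> Q \<subseteq> Q0" "X \<in> H" "bpreceq X X0"
  shows "\<exists>Y g. Y \<in> H \<and> bpreceq Y X \<and> (\<forall>Q\<in>U. perf (g Q) \<and> g Q \<subseteq> Q \<and> K (g Q) Y)"
  using assms(3,4)
proof (induct U)
  case empty
  then show ?case using assms(5) bpreceq_refl by blast
next
  case (insert Q U)
  then obtain Y g where Y: "Y \<in> H" "bpreceq Y X" "\<forall>Q\<in>U. perf (g Q) \<and> g Q \<subseteq> Q \<and> K (g Q) Y" by auto
  obtain Q' Z where Z: "perf Q'" "Q' \<subseteq> Q" "Z \<in> H" "bpreceq Z Y" "K Q' Z"
    using dense[OF _ _ Y(1) bpreceq_trans[OF Y(2) assms(6)], of Q] insert.prems by auto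
  have "K (g R) Z" if "R \<in> U" for R
    using her[of "g R" Y "g R" Z] that Y Z bpreceq_imp_star H_block_seq by blast
  then have "\<forall>R\<in>insert Q U. perf ((g(Q := Q')) R) \<and> (g(Q := Q')) R \<subseteq> R \<and> K ((g(Q := Q')) R) Z"
    using Y Z insert.hyps by auto
  moreover have "bpreceq Z X" using Y Z bpreceq_trans by blast
  ultimately show ?case using Z(3) by blast
qed

text \<open>Stage \<open>n\<close> answers question \<open>e n\<close> on every node of the current
  level and then splits the nodes. The answer refers to \<open>Xs (Suc n)\<close>, and the final
  \<open>X\<close> lies below it only modulo finite, hence the form of \<open>her\<close>.\<close>

theorem fusion:
  assumes I: "countable I"
    and her: "\<And>i Q X Q' X'. i \<in> I \<Longrightarrow> K i Q X \<Longrightarrow> Q' \<subseteq> Q \<Longrightarrow> X \<in> H \<Longrightarrow> X' \<in> H \<Longrightarrow> bpreceq_star X' X \<Longrightarrow> K i Q' X'"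
    and dense: "\<And>i Q X. i \<in> I \<Longrightarrow> perf Q \<Longrightarrow> Q \<subseteq> Q0 \<Longrightarrow> X \<in> H \<Longrightarrow> bpreceq X X0 \<Longrightarrow>
        \<exists>Q' Y. perf Q' \<and> Q' \<subseteq> Q \<and> Y \<in> H \<and> bpreceq Y X \<and> K i Q' Y"
    and Q0: "perf Q0" and X0: "X0 \<in> H"
  shows "\<exists>P X. perf P \<and> P \<subseteq> Q0 \<and> X \<in> H \<and> bpreceq X X0 \<and>
    (\<forall>i\<in>I. \<forall>t\<in>P. \<exists>V. open V \<and> t \<in> V \<and> K i (P \<inter> V) X)"
proof (cases "I = {}")
  case True
  then show ?thesis using Q0 X0 bpreceq_refl by blast
next
  case False
  define e where "e = from_nat_into I"
  have e: "e n \<in> I" for n by (simp add: e_def from_nat_into False)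
  define good where "good n l r U V X \<longleftrightarrow> V = l ` U \<union> r ` U \<and>
     (\<forall>Q\<in>U. l Q \<subseteq> Q \<and> r Q \<subseteq> Q \<and> perf (l Q) \<and> perf (r Q) \<and> l Q \<inter> r Q = {} \<and>
        K (e n) (l Q) X \<and> K (e n) (r Q) X) \<and>
     (\<forall>Q\<in>V. \<forall>x\<in>Q. \<forall>y\<in>Q. dist x y \<le> 1 / Suc n)" for n and l r :: "real set \<Rightarrow> real set" and U V X
  define ok where "ok n s \<longleftrightarrow> finite (fst s) \<and> (\<forall>Q\<in>fst s. perf Q \<and> Q \<subseteq> Q0) \<and> snd s \<in> H \<and>
     bpreceq (snd s) X0 \<and> (n = (0::nat) \<longrightarrow> s = ({Q0}, X0))" for n and s :: "real set set \<times> _"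
  have "\<exists>f. \<forall>n. ok n (f n) \<and> (bpreceq (snd (f (Suc n))) (snd (f n)) \<and>
      (\<exists>l r. good n l r (fst (f n)) (fst (f (Suc n))) (snd (f (Suc n)))))"
  proof (rule dependent_nat_choice[where P = ok and Q = "\<lambda>n s s'. bpreceq (snd s') (snd s) \<and>
      (\<exists>l r. good n l r (fst s) (fst s') (snd s'))"])
    show "\<exists>s. ok 0 s" using Q0 X0 bpreceq_refl by (auto simp: ok_def)
  next
    fix s n assume s: "ok n s"
    have "\<exists>Y g. Y \<in> H \<and> bpreceq Y (snd s) \<and> (\<forall>Q\<in>fst s. perf (g Q) \<and> g Q \<subseteq> Q \<and> K (e n) (g Q) Y)"
      by (rule fusion_step[of "K (e n)" Q0 X0, OF her[OF e] dense[OF e]])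
        (use s in \<open>auto simp: ok_def\<close>)
    then obtain Y g where Y: "Y \<in> H" "bpreceq Y (snd s)" "\<forall>Q\<in>fst s. perf (g Q) \<and> g Q \<subseteq> Q \<and> K (e n) (g Q) Y"
      by blast
    have "\<exists>l r. \<forall>Q\<in>fst s. perf (l Q) \<and> perf (r Q) \<and> l Q \<subseteq> g Q \<and> r Q \<subseteq> g Q \<and> l Q \<inter> r Q = {} \<and>
      (\<forall>x\<in>l Q. \<forall>y\<in>l Q. dist x y \<le> 1 / Suc n) \<and> (\<forall>x\<in>r Q. \<forall>y\<in>r Q. dist x y \<le> 1 / Suc n)"
    proof -
      have "\<exists>A B. perf A \<and> perf B \<and> A \<subseteq> g Q \<and> B \<subseteq> g Q \<and> A \<inter> B = {} \<and>
      (\<forall>x\<in>A. \<forall>y\<in>A. dist x y \<le> 1 / Suc n) \<and> (\<forall>x\<in>B. \<forall>y\<in>B. dist x y \<le> 1 / Suc n)" if "Q \<in> fst s" for Q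
        using perf_split[of "g Q" "1 / Suc n"] Y that by (smt (verit) divide_pos_pos of_nat_0_less_iff zero_less_Suc)
      then show ?thesis by metis
    qed
    then obtain l r where lr: "\<forall>Q\<in>fst s. perf (l Q) \<and> perf (r Q) \<and> l Q \<subseteq> g Q \<and> r Q \<subseteq> g Q \<and> l Q \<inter> r Q = {} \<and>
      (\<forall>x\<in>l Q. \<forall>y\<in>l Q. dist x y \<le> 1 / Suc n) \<and> (\<forall>x\<in>r Q. \<forall>y\<in>r Q. dist x y \<le> 1 / Suc n)" by blast
    \<comment> \<open>Splitting after the question has been answered costs nothing: both children
      lie inside \<open>g Q\<close>.\<close>
    have KY: "K (e n) Q' Y" if "Q \<in> fst s" "Q' \<subseteq> g Q" for Q Q'
      using her[OF e, of n "g Q" Y Q' Y] that Y bpreceq_imp_star[OF H_block_seq bpreceq_refl] by blast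
    have "good n l r (fst s) (l ` fst s \<union> r ` fst s) Y"
      unfolding good_def
    proof (intro conjI ballI)
      fix Q x y assume "Q \<in> l ` fst s \<union> r ` fst s" "x \<in> Q" "y \<in> Q"
      then show "dist x y \<le> 1 / Suc n" using lr by blast
    next
      fix Q assume Q: "Q \<in> fst s"
      have lrQ: "l Q \<subseteq> g Q" "r Q \<subseteq> g Q" "g Q \<subseteq> Q" using lr Y(3) Q by simp_all
      then show "l Q \<subseteq> Q" "r Q \<subseteq> Q" by auto
      show "K (e n) (l Q) Y" "K (e n) (r Q) Y" using KY[OF Q] lrQ by simp_all
      show "perf (l Q)" "perf (r Q)" "l Q \<inter> r Q = {}" using lr Q by simp_all
    qed simp
    moreover have "ok (Suc n) (l ` fst s \<union> r ` fst s, Y)"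
      unfolding ok_def
    proof (intro conjI ballI)
      fix Q' assume "Q' \<in> fst (l ` fst s \<union> r ` fst s, Y)"
      then obtain Q where Q: "Q \<in> fst s" "Q' = l Q \<or> Q' = r Q" by auto
      have "l Q \<subseteq> g Q" "r Q \<subseteq> g Q" "g Q \<subseteq> Q" "Q \<subseteq> Q0" using lr Y(3) Q(1) s by (simp_all add: ok_def)
      then show "Q' \<subseteq> Q0" using Q(2) by auto
      show "perf Q'" using lr Q by auto
    qed (use s Y bpreceq_trans[OF Y(2)] in \<open>simp_all add: ok_def\<close>)
    ultimately show "\<exists>s'. ok (Suc n) s' \<and> (bpreceq (snd s') (snd s) \<and> (\<exists>l r. good n l r (fst s) (fst s') (snd s')))"
      using Y by (intro exI[of _ "(l ` fst s \<union> r ` fst s, Y)"]) auto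
  qed
  then obtain f where f: "\<And>n. ok n (f n)" "\<And>n. bpreceq (snd (f (Suc n))) (snd (f n))"
     "\<And>n. \<exists>l r. good n l r (fst (f n)) (fst (f (Suc n))) (snd (f (Suc n)))" by blast
  obtain l r where g: "\<And>n. good n (l n) (r n) (fst (f n)) (fst (f (Suc n))) (snd (f (Suc n)))"
    using f(3) by metis
  define U where "U n = fst (f n)" for n
  define Xs where "Xs n = snd (f n)" for n
  have f0: "U 0 = {Q0}" "Xs 0 = X0" using f(1)[of 0] by (auto simp: ok_def U_def Xs_def)
  have Xs: "Xs n \<in> H" "bpreceq (Xs (Suc n)) (Xs n)" for n using f by (auto simp: Xs_def ok_def)
  obtain X where X: "X \<in> H" "bpreceq X X0" "\<And>n. bpreceq_star X (Xs n)"
    using H_lower_bound[of Xs] Xs f0 by auto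
  note g' = g[folded U_def Xs_def, unfolded good_def]
  define P where "P = (\<Inter>n. \<Union>(U n))"
  have *: "compact Q0" "Q0 \<noteq> {}" "\<And>n. U (Suc n) = l n ` U n \<union> r n ` U n"
     "\<And>n K. K \<in> U n \<Longrightarrow> l n K \<subseteq> K" "\<And>n K. K \<in> U n \<Longrightarrow> r n K \<subseteq> K"
     "\<And>n K. K \<in> U n \<Longrightarrow> compact (l n K)" "\<And>n K. K \<in> U n \<Longrightarrow> compact (r n K)"
     "\<And>n K. K \<in> U n \<Longrightarrow> l n K \<noteq> {}" "\<And>n K. K \<in> U n \<Longrightarrow> r n K \<noteq> {}"
     "\<And>n K. K \<in> U n \<Longrightarrow> l n K \<inter> r n K = {}"
     "\<And>n K x y. K \<in> U (Suc n) \<Longrightarrow> x \<in> K \<Longrightarrow> y \<in> K \<Longrightarrow> dist x y \<le> 1 / Suc n"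
                      apply (use Q0 in \<open>simp add: perf_def\<close>)
                     apply (use Q0 in \<open>simp add: perf_def\<close>)
                    apply (use g' in blast)
                   apply (use g' in blast)
                  apply (use g' in blast)
    using g' unfolding perf_def by blast+
  have cs: "perf P" "P \<subseteq> Q0" "\<And>n t. t \<in> P \<Longrightarrow> \<exists>K\<in>U n. \<exists>V. open V \<and> t \<in> V \<and> P \<inter> V \<subseteq> K"
    unfolding P_def using cantor_scheme[of U Q0 l r] f0(1) * by auto
  have "\<exists>V. open V \<and> t \<in> V \<and> K i (P \<inter> V) X" if "i \<in> I" "t \<in> P" for i t
  proof -
    obtain n where n: "i = e n" using from_nat_into_surj[OF I \<open>i \<in> I\<close>] by (auto simp: e_def)
    obtain Q V where Q: "Q \<in> U (Suc n)" "open V" "t \<in> V" "P \<inter> V \<subseteq> Q" using cs(3)[OF \<open>t \<in> P\<close>] by blast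
    then have "K (e n) Q (Xs (Suc n))" using g'[of n] by auto
    then have "K i (P \<inter> V) X" using her[OF e, of n Q "Xs (Suc n)" "P \<inter> V" X] n Q X Xs by blast
    then show ?thesis using Q by blast
  qed
  then show ?thesis using cs X by blast
qed

text \<open>Fusion for questions that do not mention the parameter: the answer is read off at any
  point of the nonempty set \<open>P\<close>.\<close>

corollary diagonalisation:
  assumes "countable I"
    and her: "\<And>i X X'. i \<in> I \<Longrightarrow> K i X \<Longrightarrow> X \<in> H \<Longrightarrow> X' \<in> H \<Longrightarrow> bpreceq_star X' X \<Longrightarrow> K i X'"
    and dense: "\<And>i X. i \<in> I \<Longrightarrow> X \<in> H \<Longrightarrow> bpreceq X X0 \<Longrightarrow> \<exists>Y. Y \<in> H \<and> bpreceq Y X \<and> K i Y"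
    and X0: "X0 \<in> H"
  obtains X where "X \<in> H" "bpreceq X X0" "\<And>i. i \<in> I \<Longrightarrow> K i X"
proof -
  have "\<exists>P X. perf P \<and> P \<subseteq> {0..1} \<and> X \<in> H \<and> bpreceq X X0 \<and>
    (\<forall>i\<in>I. \<forall>t\<in>P. \<exists>V. open V \<and> t \<in> V \<and> K i X)"
  proof (rule fusion)
    fix i Q X assume "i \<in> I" "perf Q" "X \<in> H" "bpreceq X X0"
    then show "\<exists>Q' Y. perf Q' \<and> Q' \<subseteq> Q \<and> Y \<in> H \<and> bpreceq Y X \<and> K i Y" using dense by blast
  qed (use assms perf_Icc in auto)
  then show ?thesis using that by (metis ex_in_conv perf_def)
qed

text \<open>Fusion for the questions whether \<open>c\<close> is omitted; of two disjoint perfect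
  pieces at least one omits it.\<close>

lemma perf_avoid_countable:
  assumes "perf Q" "countable C"
  obtains P where "perf P" "P \<subseteq> Q" "P \<inter> C = {}"
proof -
  obtain X0 where X0: "X0 \<in> H" using H_nonempty by blast
  have "\<exists>P X. perf P \<and> P \<subseteq> Q \<and> X \<in> H \<and> bpreceq X X0 \<and>
    (\<forall>c\<in>C. \<forall>t\<in>P. \<exists>V. open V \<and> t \<in> V \<and> c \<notin> P \<inter> V)"
  proof (rule fusion)
    fix c R X assume "perf R" "X \<in> H"
    obtain A B where "perf A" "perf B" "A \<subseteq> R" "B \<subseteq> R" "A \<inter> B = {}"
      using perf_split[OF \<open>perf R\<close> zero_less_one] .
    then show "\<exists>R' Y. perf R' \<and> R' \<subseteq> R \<and> Y \<in> H \<and> bpreceq Y X \<and> c \<notin> R'"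
      using \<open>X \<in> H\<close> bpreceq_refl by blast
  qed (use assms X0 in auto)
  then show ?thesis using that by blast
qed

end

section \<open>Strategies for II from state machines\<close>

text \<open>The machine is fed the tail of I's move beyond its own last answer; this keeps its answers
  in block position.\<close>
primrec run_state :: "('s \<Rightarrow> (nat \<Rightarrow> nat \<Rightarrow> 'f::zero) \<Rightarrow> (nat \<Rightarrow> 'f) \<times> 's) \<Rightarrow> 's \<Rightarrow>
    (nat \<Rightarrow> nat \<Rightarrow> nat \<Rightarrow> 'f) \<Rightarrow> nat \<Rightarrow> (nat \<Rightarrow> 'f) \<times> 's" where
  "run_state N s Ys 0 = N s (tail_above (Ys 0) 0)"
| "run_state N s Ys (Suc k) = (let (y, s') = run_state N s Ys k in
     N s' (tail_above (Ys (Suc k)) (Max (supp y))))"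

lemma run_state_cong:
  assumes "\<And>i. i \<le> k \<Longrightarrow> Ys i = Ys' i" shows "run_state N s Ys k = run_state N s Ys' k"
  using assms by (induct k) auto

text \<open>The state may hold information that the answers of II do not determine, such as a plan
  or a level of a Cantor scheme. Each outcome comes with a run of states, so properties of outcomes
  can be proved from \<open>step\<close> alone.\<close>

lemma state_machine_strategy:
  fixes X :: "nat \<Rightarrow> nat \<Rightarrow> 'f::field"
  assumes s0: "Inv s0"
    and step: "\<And>s Z. Inv s \<Longrightarrow> block_seq Z \<Longrightarrow> bpreceq Z X \<Longrightarrow>
      \<exists>z\<in>span_of Z. z \<noteq> 0 \<and> (\<exists>s'. Inv s' \<and> step s z s')"
  obtains \<alpha> where "strategy_II_G X \<alpha>"
    "\<And>Y. Y \<in> G_outcomes_II X \<alpha> \<Longrightarrow> \<exists>ss. ss 0 = s0 \<and> (\<forall>k. Inv (ss k) \<and> step (ss k) (Y k) (ss (Suc k)))"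
proof -
  define N where "N s Z = (SOME p. fst p \<in> span_of Z \<and> fst p \<noteq> 0 \<and> Inv (snd p) \<and> step s (fst p) (snd p))" for s Z
  have N: "fst (N s Z) \<in> span_of Z \<and> fst (N s Z) \<noteq> 0 \<and> Inv (snd (N s Z)) \<and> step s (fst (N s Z)) (snd (N s Z))"
    if "Inv s" "block_seq Z" "bpreceq Z X" for s Z
    unfolding N_def by (rule someI_ex) (use step[OF that] in auto)
  \<comment> \<open>II answers after I, so the current move has index \<open>length xs - 1\<close>.
    By \<open>run_state_cong\<close> no entry past the end of the list is consulted.\<close>
  define \<alpha> where "\<alpha> xs = fst (run_state N s0 (\<lambda>i. xs ! i) (length xs - 1))" for xs
  have play: "G_play \<alpha> Ys k = fst (run_state N s0 Ys k)" for Ys k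
    unfolding G_play_def \<alpha>_def
    by (rule arg_cong[where f = fst], simp del: upt_Suc, rule run_state_cong, simp del: upt_Suc)
  have main: "strategy_II_G X \<alpha> \<and> (\<forall>Ys. G_legal_I X Ys \<longrightarrow>
    (\<exists>ss. ss 0 = s0 \<and> (\<forall>k. Inv (ss k) \<and> step (ss k) (G_play \<alpha> Ys k) (ss (Suc k)))))"
  proof -
    have "((\<forall>k. G_play \<alpha> Ys k \<in> span_of (Ys k) \<and> supp (G_play \<alpha> Ys k) \<noteq> {}) \<and> block_seq (G_play \<alpha> Ys)) \<and>
      (\<exists>ss. ss 0 = s0 \<and> (\<forall>k. Inv (ss k) \<and> step (ss k) (G_play \<alpha> Ys k) (ss (Suc k))))"
      if leg: "G_legal_I X Ys" for Ys
    proof -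
      let ?R = "run_state N s0 Ys"
      define ss where "ss k = (case k of 0 \<Rightarrow> s0 | Suc j \<Rightarrow> snd (?R j))" for k
      define m where "m k = (case k of 0 \<Rightarrow> 0 | Suc j \<Rightarrow> Max (supp (fst (?R j))))" for k
      have R: "?R k = N (ss k) (tail_above (Ys k) (m k))" for k
        by (cases k) (auto simp: ss_def m_def split: prod.split)
      have Y: "block_seq (Ys k)" "bpreceq (Ys k) X" for k using leg by (auto simp: G_legal_I_def)
      have T: "block_seq (tail_above (Ys k) n)" "bpreceq (tail_above (Ys k) n) X" for k n
        using Y[of k] block_seq_tail_above bpreceq_tail_above bpreceq_trans by blast+
      have I: "Inv (ss k)" for k
      proof (induct k)
        case (Suc k)
        then show ?case using N[OF Suc T] R[of k] by (simp add: ss_def)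
      qed (simp add: ss_def s0)
      have n: "fst (?R k) \<in> span_of (tail_above (Ys k) (m k))" "fst (?R k) \<noteq> 0"
        "step (ss k) (fst (?R k)) (ss (Suc k))" for k
        using N[OF I T, of k k "m k"] R[of k] by (simp_all add: ss_def)
      have ab: "above (m k) (fst (?R k))" for k
        using above_span_tail_above[OF Y(1) n(1)] .
      have inY: "fst (?R k) \<in> span_of (Ys k)" for k
        using n(1)[of k] bpreceq_tail_above[OF Y(1)] by (auto simp: bpreceq_def)
      have ev: "fst (?R k) \<in> Evec" for k using inY span_of_subset_Evec[OF Y(1)] by blast
      have ne: "supp (fst (?R k)) \<noteq> {}" for k using n(2) by (simp add: supp_eq_empty_iff)
      have "block_seq (G_play \<alpha> Ys)"
        unfolding block_seq_def play
      proof (intro conjI allI)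
        fix k show "Max (supp (fst (?R k))) < Min (supp (fst (?R (Suc k))))"
          using ab[of "Suc k"] ev[of "Suc k"] ne[of "Suc k"] by (auto simp: m_def above_def Evec_def)
      qed (use ev ne in auto)
      then show ?thesis
        using inY ne I n(3) by (auto simp: play intro!: exI[of _ ss]) (simp add: ss_def)
    qed
    then show ?thesis unfolding strategy_II_G_def by blast
  qed
  show ?thesis
    by (rule that[of \<alpha>]) (use main in \<open>auto simp: G_outcomes_II_def\<close>)
qed

section \<open>Runs of II whose outcome lies in the family\<close>

context strategic_p_plus
begin

text \<open>Fullness in contrapositive form for the complement of \<open>T\<close>: the failure of
  density is witnessed by \<open>Y\<close>. It upgrades meeting \<open>T\<close> from sequences in
  \<open>H\<close> to all block sequences.\<close>

lemma full_meets_all: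
  assumes "X \<in> H" and meets: "\<And>Y. Y \<in> H \<Longrightarrow> bpreceq Y X \<Longrightarrow> span_of Y \<inter> T \<noteq> {}"
  obtains Y where "Y \<in> H" "bpreceq Y X" "\<And>Z. block_seq Z \<Longrightarrow> bpreceq Z Y \<Longrightarrow> span_of Z \<inter> T \<noteq> {}"
proof -
  have "\<not> dense_below H (Evec - T) X"
  proof
    assume "dense_below H (Evec - T) X"
    moreover have "full_family H" using pplus by (simp add: p_plus_family_def)
    ultimately obtain Z where "Z \<in> restr H X" "span_of Z \<subseteq> Evec - T"
      using \<open>X \<in> H\<close> unfolding full_family_def by blast
    then show False using meets by (auto simp: restr_def)
  qed
  then obtain Y where Y: "Y \<in> H" "bpreceq Y X"
    "\<And>Z. block_seq Z \<Longrightarrow> bpreceq Z Y \<Longrightarrow> \<not> span_of Z \<subseteq> Evec - T"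
    by (auto simp: dense_below_def restr_def)
  then show ?thesis using that span_of_subset_Evec by blast
qed

text \<open>II is assumed to have an answer only inside sequences from \<open>H\<close>, but I may
  play any block sequence. \<open>full_meets_all\<close> closes the gap for one state,
  diagonalisation for all states at once; this is why states must be countable in number. Being
  strategic then puts an outcome into \<open>H\<close>.\<close>

lemma strategic_run:
  fixes S :: "'s set"
  assumes "X \<in> H" "countable S" "s0 \<in> S"
    and step: "\<And>s Y. s \<in> S \<Longrightarrow> Y \<in> H \<Longrightarrow> bpreceq Y X \<Longrightarrow>
       \<exists>z\<in>span_of Y. z \<noteq> 0 \<and> (\<exists>s'\<in>S. step s z s')"
  obtains Z ss where "Z \<in> H" "bpreceq Z X" "ss 0 = s0" "\<And>k. ss k \<in> S \<and> step (ss k) (Z k) (ss (Suc k))"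
proof -
  define T where "T s = {z. z \<noteq> 0 \<and> (\<exists>s'\<in>S. step s z s')}" for s
  obtain Y where Y: "Y \<in> H" "bpreceq Y X"
    and T: "\<And>s. s \<in> S \<Longrightarrow> \<forall>Z. block_seq Z \<longrightarrow> bpreceq Z Y \<longrightarrow> span_of Z \<inter> T s \<noteq> {}"
  proof (rule diagonalisation[OF \<open>countable S\<close>,
        where K = "\<lambda>s Y. \<forall>Z. block_seq Z \<longrightarrow> bpreceq Z Y \<longrightarrow> span_of Z \<inter> T s \<noteq> {}" and ?X0.0 = X])
    fix s Y Y'
    assume a: "\<forall>Z. block_seq Z \<longrightarrow> bpreceq Z Y \<longrightarrow> span_of Z \<inter> T s \<noteq> {}"
      "Y \<in> H" "Y' \<in> H" "bpreceq_star Y' Y"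
    show "\<forall>Z. block_seq Z \<longrightarrow> bpreceq Z Y' \<longrightarrow> span_of Z \<inter> T s \<noteq> {}"
    proof (intro allI impI)
      fix Z assume Z: "block_seq Z" "bpreceq Z Y'"
      obtain n where "bpreceq (tail_above Z n) Y" using bpreceq_star_tail[OF H_block_seq Z(1) a(4) Z(2)] a by blast
      then have "span_of (tail_above Z n) \<inter> T s \<noteq> {}" using a block_seq_tail_above[OF Z(1)] by blast
      then show "span_of Z \<inter> T s \<noteq> {}" using bpreceq_tail_above[OF Z(1), of n] by (auto simp: bpreceq_def)
    qed
  next
    fix s Y assume s: "s \<in> S" "Y \<in> H" "bpreceq Y X"
    show "\<exists>Y'. Y' \<in> H \<and> bpreceq Y' Y \<and> (\<forall>Z. block_seq Z \<longrightarrow> bpreceq Z Y' \<longrightarrow> span_of Z \<inter> T s \<noteq> {})"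
    proof (rule full_meets_all[OF s(2), of "T s"])
      fix Y' assume "Y' \<in> H" "bpreceq Y' Y"
      then show "span_of Y' \<inter> T s \<noteq> {}" using step[OF s(1), of Y'] s(3) bpreceq_trans by (fastforce simp: T_def)
    qed blast
  qed (use assms in auto)
  obtain \<alpha> where \<alpha>: "strategy_II_G Y \<alpha>"
    "\<And>W. W \<in> G_outcomes_II Y \<alpha> \<Longrightarrow> \<exists>ss. ss 0 = s0 \<and> (\<forall>k. ss k \<in> S \<and> step (ss k) (W k) (ss (Suc k)))"
  proof (rule state_machine_strategy[where Inv = "\<lambda>s. s \<in> S" and step = step and X = Y and ?s0.0 = s0])
    fix s Z assume "s \<in> S" "block_seq Z" "bpreceq Z Y"
    then have "span_of Z \<inter> T s \<noteq> {}" using T by blast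
    then show "\<exists>z\<in>span_of Z. z \<noteq> 0 \<and> (\<exists>s'. s' \<in> S \<and> step s z s')" by (auto simp: T_def)
  qed (use assms in auto)
  then obtain Z where Z: "Z \<in> G_outcomes_II Y \<alpha>" "Z \<in> H"
    using strat Y(1) unfolding strategic_def by blast
  then obtain Ys where Ys: "Z = G_play \<alpha> Ys" "G_legal_I Y Ys" by (auto simp: G_outcomes_II_def)
  have "bpreceq Z Y" unfolding bpreceq_iff
  proof
    fix k
    have "Z k \<in> span_of (Ys k)" using \<alpha>(1) Ys by (auto simp: strategy_II_G_def)
    then show "Z k \<in> span_of Y" using Ys(2) by (auto simp: G_legal_I_def bpreceq_def)
  qed
  then have "bpreceq Z X" using Y bpreceq_trans by blast
  then show ?thesis using \<alpha>(2)[OF Z(1)] Z(2) that by blast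
qed

end

section \<open>Fullness with a perfect set of parameters\<close>

lemma span_of_initial:
  assumes "v \<in> span_of Z" obtains k where "v \<in> vs.span (set (map Z [0..<k]))"
proof -
  obtain c where c: "finite {n. c n \<noteq> 0}" "v = (\<lambda>i. \<Sum>n\<in>{n. c n \<noteq> 0}. c n * Z n i)"
    using assms by (auto simp: span_of_def)
  then obtain k where k: "{n. c n \<noteq> 0} \<subseteq> {..<k}" by (metis finite_nat_iff_bounded)
  have "v = (\<Sum>n\<in>{n. c n \<noteq> 0}. (\<lambda>i. c n * Z n i))"
    unfolding c(2) by (simp add: fun_eq_iff sum_fun_apply)
  also have "\<dots> \<in> vs.span (set (map Z [0..<k]))"
    using k by (intro vs.span_sum vs.span_scale vs.span_base) auto
  finally show ?thesis using that by blast
qed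

text \<open>Rational end points keep the pieces of the parameter set countable in number, as the
  states of \<open>strategic_run\<close> have to be.\<close>

lemma rational_interval:
  assumes "e > 0"
  obtains c d :: real where "c \<in> \<rat>" "d \<in> \<rat>" "c < b" "b < d" "\<And>x y. x \<in> {c..d} \<Longrightarrow> y \<in> {c..d} \<Longrightarrow> dist x y \<le> e"
proof -
  obtain c where c: "c \<in> \<rat>" "b - e/2 < c" "c < b" using Rats_dense_in_real[of "b - e/2" b] assms by auto
  obtain d where d: "d \<in> \<rat>" "b < d" "d < b + e/2" using Rats_dense_in_real[of b "b + e/2"] assms by auto
  show ?thesis by (rule that[of c d]) (use c d in \<open>auto simp: dist_real_def\<close>)
qed

context strategic_p_plus
begin

context
  fixes G :: "real \<Rightarrow> (nat \<Rightarrow> 'f) \<Rightarrow> bool" and Q :: "real set"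
  assumes Q: "compact Q"
    and G_closed: "\<And>z. z \<in> Evec \<Longrightarrow> closed {b\<in>Q. G b z}"
begin

text \<open>Limits of runs are taken in these compact sets. They contain the sets of
  \<open>extendable_params\<close>, whose cardinality is what II controls.\<close>

definition span_params :: "(nat \<Rightarrow> 'f) list \<Rightarrow> real set" where
  "span_params zs = {b\<in>Q. \<forall>v\<in>vs.span (set zs). G b v}"

text \<open>The sums \<open>v + w\<close> form the span of \<open>zs\<close> and \<open>Z\<close>
  together: \<open>b\<close> admits a continuation of \<open>zs\<close> by some \<open>Z\<close>
  from \<open>D\<close> with everything inside G(b). \<open>D\<close> will be
  \<open>block_seqs\<close> or \<open>H\<close>.\<close>

definition extendable_params :: "(nat \<Rightarrow> nat \<Rightarrow> 'f) set \<Rightarrow> (nat \<Rightarrow> 'f) list \<Rightarrow> (nat \<Rightarrow> nat \<Rightarrow> 'f) \<Rightarrow> real set" where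
  "extendable_params D zs Y = {b\<in>Q. \<exists>Z\<in>D. bpreceq Z Y \<and> (\<forall>v\<in>vs.span (set zs). \<forall>w\<in>span_of Z. G b (v + w))}"

lemma extendable_params_Nil: "extendable_params D [] Y = {b\<in>Q. \<exists>Z\<in>D. bpreceq Z Y \<and> span_of Z \<subseteq> {z. G b z}}"
  by (auto simp: extendable_params_def)

lemma compact_span_params:
  assumes "zs \<in> lists Evec" shows "compact (span_params zs)"
proof -
  have "vs.span (set zs) \<subseteq> Evec" using assms subspace_Evec by (intro vs.span_minimal) auto
  moreover have "span_params zs = Q \<inter> (\<Inter>v\<in>vs.span (set zs). {b\<in>Q. G b v})" by (auto simp: span_params_def)
  ultimately show ?thesis using Q G_closed by (auto intro!: compact_Int_closed closed_INT)
qed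

lemma extendable_params_subset: "extendable_params D zs Y \<subseteq> span_params zs"
proof
  fix b assume "b \<in> extendable_params D zs Y"
  then obtain Z where Z: "b \<in> Q" "\<And>v w. v\<in>vs.span (set zs) \<Longrightarrow> w\<in>span_of Z \<Longrightarrow> G b (v + w)" by (auto simp: extendable_params_def)
  moreover have "0 \<in> span_of Z" by (simp add: span_of_eq_span vs.span_zero)
  ultimately show "b \<in> span_params zs" by (force simp: span_params_def)
qed

lemma extendable_params_mono_star:
  assumes "D \<subseteq> block_seqs" "\<forall>Z\<in>D. \<forall>n. tail_above Z n \<in> D" "Y \<in> H" "bpreceq_star Y X"
  shows "extendable_params D zs Y \<subseteq> extendable_params D zs X"
proof
  fix b assume "b \<in> extendable_params D zs Y"
  then obtain Z where Z: "b \<in> Q" "Z \<in> D" "bpreceq Z Y" "\<forall>v\<in>vs.span (set zs). \<forall>w\<in>span_of Z. G b (v + w)"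
    by (auto simp: extendable_params_def)
  have bZ: "block_seq Z" using assms(1) Z by (auto simp: block_seqs_def)
  obtain n where "bpreceq (tail_above Z n) X" using bpreceq_star_tail[OF H_block_seq[OF assms(3)] bZ assms(4) Z(3)] .
  moreover have "span_of (tail_above Z n) \<subseteq> span_of Z" using bpreceq_tail_above[OF bZ] by (simp add: bpreceq_def)
  ultimately show "b \<in> extendable_params D zs X" using Z assms(2) unfolding extendable_params_def by blast
qed

lemma span_snoc_plus:
  assumes "v \<in> vs.span (set (zs @ [z]))" "z \<in> span_of Z" "w \<in> span_of Z"
  obtains v' w' where "v' \<in> vs.span (set zs)" "w' \<in> span_of Z" "v + w = v' + w'"
proof -
  obtain k where k: "v - (\<lambda>i. k * z i) \<in> vs.span (set zs)"
    using assms(1) by (auto simp: vs.span_breakdown_eq)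
  show ?thesis
    by (rule that[OF k, of "(\<lambda>i. k * z i) + w"])
      (use assms in \<open>auto simp: span_of_eq_span intro: vs.span_add vs.span_scale\<close>)
qed

text \<open>II may play any \<open>z\<close> from the span of a witness \<open>Z\<close> and
  \<open>Z\<close> remains a witness: the multiple of \<open>z\<close> moves from the summand
  \<open>v\<close> to the summand \<open>w\<close>.\<close>

lemma extendable_params_snocI:
  assumes "b \<in> Q" "Z \<in> D" "bpreceq Z Y" "\<forall>v\<in>vs.span (set zs). \<forall>w\<in>span_of Z. G b (v + w)" "z \<in> span_of Z"
  shows "b \<in> extendable_params D (zs @ [z]) Y"
proof -
  have "G b (v + w)" if "v \<in> vs.span (set (zs @ [z]))" "w \<in> span_of Z" for v w
    using span_snoc_plus[OF that(1) assms(5) that(2)] assms(4) by metis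
  then show ?thesis using assms by (auto simp: extendable_params_def)
qed

lemma span_params_snoc: "span_params (zs @ [z]) \<subseteq> span_params zs"
  using vs.span_mono[of "set zs" "set (zs @ [z])"] by (auto simp: span_params_def)

text \<open>Below \<open>Y\<close> each of the countably many sets is either countable already or
  uncountable for every later sequence in \<open>H\<close>. \<open>W\<close> collects the countable
  ones, so a single parameter outside \<open>W\<close> certifies that the sets containing it stay
  uncountable.\<close>

lemma decide_uncountable:
  assumes D: "D \<subseteq> block_seqs" "\<forall>Z\<in>D. \<forall>n. tail_above Z n \<in> D"
    and BB: "countable BB" and X: "X \<in> H"
  shows "\<exists>Y\<in>H. bpreceq Y X \<and> (\<exists>W. countable W \<and> (\<forall>zs\<in>lists Evec. \<forall>K\<in>BB. \<forall>b\<in>extendable_params D zs Y \<inter> K - W.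
    \<forall>Y'\<in>H. bpreceq Y' Y \<longrightarrow> uncountable (extendable_params D zs Y' \<inter> K)))"
proof -
  let ?I = "lists (Evec :: (nat \<Rightarrow> 'f) set) \<times> BB"
  let ?K = "\<lambda>(zs, K) Y. countable (extendable_params D zs Y \<inter> K) \<or> (\<forall>Y'\<in>H. bpreceq Y' Y \<longrightarrow> uncountable (extendable_params D zs Y' \<inter> K))"
  have I: "countable ?I" by (intro countable_SIGMA countable_lists BB countable_Evec)
  obtain Y where Y: "Y \<in> H" "bpreceq Y X" "\<And>i. i \<in> ?I \<Longrightarrow> ?K i Y"
  proof (rule diagonalisation[OF I, where K = ?K and ?X0.0 = X])
    fix i Y Y' assume a: "i \<in> ?I" "?K i Y" "Y \<in> H" "Y' \<in> H" "bpreceq_star Y' Y"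
    obtain zs K where i: "i = (zs, K)" by force
    show "?K i Y'"
    proof (cases "countable (extendable_params D zs Y \<inter> K)")
      case True
      then have "countable (extendable_params D zs Y' \<inter> K)"
        by (rule countable_subset[rotated]) (use extendable_params_mono_star[OF D a(4,5)] in blast)
      then show ?thesis by (simp add: i)
    next
      case False
      have "uncountable (extendable_params D zs Z \<inter> K)" if Z: "Z \<in> H" "bpreceq Z Y'" for Z
      proof
        assume c: "countable (extendable_params D zs Z \<inter> K)"
        obtain n where n: "bpreceq (tail_above Z n) Y"
          using bpreceq_star_tail[OF H_block_seq H_block_seq a(5) Z(2)] a Z by blast
        have "extendable_params D zs (tail_above Z n) \<subseteq> extendable_params D zs Z"
          using Z by (intro extendable_params_mono_star[OF D] H_tail_above) (auto intro!: bpreceq_imp_star bpreceq_tail_above block_seq_tail_above intro: H_block_seq H_tail_above)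
        with c have "countable (extendable_params D zs (tail_above Z n) \<inter> K)" by (meson Int_mono countable_subset order_refl)
        then show False using n a(2) False H_tail_above[OF Z(1)] by (auto simp: i)
      qed
      then show ?thesis by (simp add: i)
    qed
  next
    fix i Y assume "i \<in> ?I" "Y \<in> H"
    obtain zs K where i: "i = (zs, K)" by force
    show "\<exists>Y'. Y' \<in> H \<and> bpreceq Y' Y \<and> ?K i Y'"
    proof (cases "\<exists>Y'\<in>H. bpreceq Y' Y \<and> countable (extendable_params D zs Y' \<inter> K)")
      case True
      then show ?thesis by (auto simp: i)
    next
      case False
      then show ?thesis using \<open>Y \<in> H\<close> bpreceq_refl[of Y] by (intro exI[of _ Y]) (auto simp: i)
    qed
  qed (use X in auto)
  define W where "W = (\<Union>(zs, K)\<in>{i\<in>?I. countable (extendable_params D (fst i) Y \<inter> snd i)}. extendable_params D zs Y \<inter> K)"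
  show ?thesis
  proof (intro bexI[OF _ Y(1)] conjI exI ballI impI)
    show "bpreceq Y X" by fact
    show "countable W" unfolding W_def using I by (auto intro!: countable_UN)
  next
    fix zs K b Y' assume *: "zs \<in> lists Evec" "K \<in> BB" "b \<in> extendable_params D zs Y \<inter> K - W" "Y' \<in> H" "bpreceq Y' Y"
    then have "\<not> countable (extendable_params D zs Y \<inter> K)" by (fastforce simp: W_def)
    then show "uncountable (extendable_params D zs Y' \<inter> K)" using Y(3)[of "(zs, K)"] * by auto
  qed
qed

text \<open>One branch: II keeps uncountably many parameters alive, and compactness provides one that
  survives the whole run.\<close>
lemma single_parameter:
  assumes X: "X \<in> H" and unc: "\<And>Y. Y \<in> H \<Longrightarrow> bpreceq Y X \<Longrightarrow> uncountable (extendable_params block_seqs [] Y)"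
  shows "\<exists>b\<in>Q. \<exists>Z\<in>H. bpreceq Z X \<and> span_of Z \<subseteq> {z. G b z}"
proof -
  let ?extendable_params = "extendable_params block_seqs"
  have D: "\<forall>Z\<in>block_seqs. \<forall>n. tail_above Z n \<in> (block_seqs :: (nat \<Rightarrow> nat \<Rightarrow> 'f) set)"
    by (auto simp: block_seqs_def intro: block_seq_tail_above)
  have "countable {UNIV :: real set}" by simp
  from decide_uncountable[OF subset_refl D this X]
  obtain Y W where Y: "Y \<in> H" "bpreceq Y X" "countable W" and
    big': "\<forall>zs\<in>lists Evec. \<forall>K\<in>{UNIV}. \<forall>b\<in>?extendable_params zs Y \<inter> K - W. \<forall>Y'\<in>H. bpreceq Y' Y \<longrightarrow> uncountable (?extendable_params zs Y' \<inter> K)"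
    by (elim bexE conjE exE) (rule that)
  have big: "uncountable (?extendable_params zs Y')" if "zs \<in> lists Evec" "b \<in> ?extendable_params zs Y" "b \<notin> W" "Y' \<in> H" "bpreceq Y' Y" for zs b Y'
    using big' that by auto
  define S where "S = {zs \<in> lists Evec. \<forall>Y'\<in>H. bpreceq Y' Y \<longrightarrow> uncountable (?extendable_params zs Y')}"
  obtain Z ss where Z: "Z \<in> H" "bpreceq Z Y" "ss 0 = []" and
    ss: "\<And>k. ss k \<in> S \<and> ss (Suc k) = ss k @ [Z k]"
  proof (rule strategic_run[OF Y(1), of S "[]" "\<lambda>zs z zs'. zs' = zs @ [z]"])
    have "S \<subseteq> lists Evec" by (auto simp: S_def)
    then show "countable S" using countable_Evec countable_lists countable_subset by blast
    show "[] \<in> S" using unc Y(2) bpreceq_trans by (auto simp: S_def)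
  next
    fix zs Y' assume s: "zs \<in> S" "Y' \<in> H" "bpreceq Y' Y"
    then have "uncountable (?extendable_params zs Y')" by (auto simp: S_def)
    then have "\<not> ?extendable_params zs Y' \<subseteq> W" using Y(3) countable_subset by blast
    then obtain b where b: "b \<in> ?extendable_params zs Y'" "b \<notin> W" by blast
    then obtain Z where Z: "b \<in> Q" "Z \<in> block_seqs" "bpreceq Z Y'" "\<forall>v\<in>vs.span (set zs). \<forall>w\<in>span_of Z. G b (v + w)"
      by (auto simp: extendable_params_def)
    have bZ: "block_seq Z" using Z by (simp add: block_seqs_def)
    have ev: "zs @ [Z 0] \<in> lists Evec" using s bZ by (auto simp: S_def block_seq_def)
    have "b \<in> ?extendable_params (zs @ [Z 0]) Y"
      using extendable_params_snocI[OF Z(1,2) bpreceq_trans[OF Z(3) s(3)] Z(4) span_of_base] .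
    then have "zs @ [Z 0] \<in> S" using big[OF ev, of b] b(2) ev by (auto simp: S_def)
    moreover have "Z 0 \<in> span_of Y'" "Z 0 \<noteq> 0" using Z(3) bZ by (auto simp: bpreceq_iff block_seq_def supp_eq_empty_iff)
    ultimately show "\<exists>z\<in>span_of Y'. z \<noteq> 0 \<and> (\<exists>s'\<in>S. s' = zs @ [z])" by blast
  qed (use that in blast)
  have ss_eq: "ss k = map Z [0..<k]" for k by (induct k) (use Z ss in auto)
  have "(\<Inter>k. span_params (ss k)) \<noteq> {}"
  proof (rule compact_nest)
    show "compact (span_params (ss k))" for k using ss[of k] by (auto simp: S_def intro: compact_span_params)
    have "uncountable (?extendable_params (ss k) Y)" for k using ss[of k] Y bpreceq_refl by (auto simp: S_def)
    then show "span_params (ss k) \<noteq> {}" for k using extendable_params_subset[of block_seqs "ss k" Y]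
      by (metis countable_empty subset_empty)
    show "span_params (ss n) \<subseteq> span_params (ss m)" if "m \<le> n" for m n
      using that by (rule lift_Suc_antimono_le[rotated]) (use ss span_params_snoc in auto)
  qed
  then obtain b where b: "\<And>k. b \<in> span_params (ss k)" by blast
  have "G b v" if "v \<in> span_of Z" for v
  proof -
    obtain k where "v \<in> vs.span (set (map Z [0..<k]))" using span_of_initial[OF \<open>v \<in> span_of Z\<close>] .
    then show ?thesis using b[of k] by (simp add: span_params_def ss_eq)
  qed
  moreover have "b \<in> Q" using b[of 0] by (simp add: span_params_def)
  ultimately show ?thesis using Z bpreceq_trans[OF Z(2) Y(2)] by blast
qed

text \<open>Since witnesses come from \<open>H\<close>, the next parameter can be sought below the
  previous witness. The last sequence is thus a common witness for all chosen parameters, and one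
  vector of it answers for all pieces simultaneously.\<close>

lemma two_points_each:
  assumes "finite U" "countable W" "Y \<in> H"
    and unc: "\<And>K Y'. K \<in> U \<Longrightarrow> Y' \<in> H \<Longrightarrow> bpreceq Y' Y \<Longrightarrow> uncountable (extendable_params H zs Y' \<inter> K)"
  shows "\<exists>Z\<in>H. bpreceq Z Y \<and> (\<exists>f g. \<forall>K\<in>U. f K \<noteq> g K \<and> (\<forall>b\<in>{f K, g K}. b \<in> K - W \<and> b \<in> Q \<and>
      (\<forall>v\<in>vs.span (set zs). \<forall>w\<in>span_of Z. G b (v + w))))"
  using assms(1) unc
proof (induct U)
  case empty
  then show ?case by (intro bexI[OF _ assms(3)]) (simp add: bpreceq_refl)
next
  case (insert K U)
  have "\<exists>Z\<in>H. bpreceq Z Y \<and> (\<exists>f g. \<forall>K\<in>U. f K \<noteq> g K \<and> (\<forall>b\<in>{f K, g K}. b \<in> K - W \<and> b \<in> Q \<and>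
      (\<forall>v\<in>vs.span (set zs). \<forall>w\<in>span_of Z. G b (v + w))))"
    by (rule insert.hyps(3)) (rule insert.prems, simp_all)
  then obtain Z f g where Z: "Z \<in> H" "bpreceq Z Y" and fg: "\<forall>K\<in>U. f K \<noteq> g K \<and> (\<forall>b\<in>{f K, g K}. b \<in> K - W \<and> b \<in> Q \<and>
      (\<forall>v\<in>vs.span (set zs). \<forall>w\<in>span_of Z. G b (v + w)))"
    by blast
  have new: "\<exists>b\<in>K - V. b \<in> Q \<and> (\<exists>Z'\<in>H. bpreceq Z' Y' \<and> (\<forall>v\<in>vs.span (set zs). \<forall>w\<in>span_of Z'. G b (v + w)))"
    if "Y' \<in> H" "bpreceq Y' Y" "countable V" for Y' V
  proof -
    have "\<not> extendable_params H zs Y' \<inter> K \<subseteq> V" using insert.prems[of K Y'] that countable_subset by blast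
    then show ?thesis by (auto simp: extendable_params_def)
  qed
  obtain b1 Z1 where 1: "b1 \<in> K - W" "b1 \<in> Q" "Z1 \<in> H" "bpreceq Z1 Z" "\<forall>v\<in>vs.span (set zs). \<forall>w\<in>span_of Z1. G b1 (v + w)"
    using new[OF Z assms(2)] by blast
  obtain b2 Z2 where 2: "b2 \<in> K - insert b1 W" "b2 \<in> Q" "Z2 \<in> H" "bpreceq Z2 Z1" "\<forall>v\<in>vs.span (set zs). \<forall>w\<in>span_of Z2. G b2 (v + w)"
    using new[OF 1(3) bpreceq_trans[OF 1(4) Z(2)], of "insert b1 W"] assms(2) by auto
  have sub: "span_of Z2 \<subseteq> span_of Z1" "span_of Z2 \<subseteq> span_of Z" using 1 2 by (auto simp: bpreceq_def)
  show ?case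
  proof (intro bexI[OF _ 2(3)] conjI exI ballI)
    show "bpreceq Z2 Y" using 1 2 Z bpreceq_trans by blast
    fix L assume L: "L \<in> insert K U"
    show "(f(K := b1)) L \<noteq> (g(K := b2)) L" using L fg 2(1) by auto
    fix b assume b: "b \<in> {(f(K := b1)) L, (g(K := b2)) L}"
    have "(L = K \<and> b \<in> {b1, b2}) \<or> (L \<noteq> K \<and> L \<in> U \<and> b \<in> {f L, g L})" using b L by (auto split: if_splits)
    then show "b \<in> L - W" "b \<in> Q" using 1 2 fg by auto
    fix v w assume "v \<in> vs.span (set zs)" "w \<in> span_of Z2"
    then show "G b (v + w)" using sub fg 1(5) 2(5) \<open>_ \<or> _\<close> by blast
  qed
qed

text \<open>Splitting each branch in two at every move, with the answers of II lying in a common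
  sequence from H, yields a perfect set of parameters for one sequence.\<close>
lemma perfect_parameters:
  assumes X: "X \<in> H" and unc: "\<And>Y. Y \<in> H \<Longrightarrow> bpreceq Y X \<Longrightarrow> uncountable (extendable_params H [] Y)"
  shows "\<exists>P\<subseteq>Q. perf P \<and> (\<exists>Z\<in>H. bpreceq Z X \<and> (\<forall>b\<in>P. span_of Z \<subseteq> {z. G b z}))"
proof -
  \<comment> \<open>Pieces are compact, as the Cantor scheme needs, and countable in number, as
    \<open>strategic_run\<close> needs.\<close>
  define B where "B zs = {{c..d} \<inter> span_params zs | c d. c \<in> \<rat> \<and> d \<in> \<rat>}" for zs
  define BB where "BB = (\<Union>zs\<in>lists Evec. B zs)"
  have "B zs = (\<lambda>(c, d). {c..d} \<inter> span_params zs) ` (\<rat> \<times> \<rat>)" for zs unfolding B_def by auto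
  then have "countable (B zs)" for zs by (simp add: countable_rat)
  then have cBB: "countable BB" unfolding BB_def using countable_Evec by blast
  have B_compact: "compact K" if "K \<in> B zs" "zs \<in> lists Evec" for K zs
    using that compact_span_params by (auto simp: B_def intro!: closed_Int_compact)
  have B_C: "K \<subseteq> span_params zs" if "K \<in> B zs" for K zs using that by (auto simp: B_def)
  have B_step: "K \<inter> {c..d} \<inter> span_params (zs @ [z]) \<in> B (zs @ [z])" if "K \<in> B zs" "c \<in> \<rat>" "d \<in> \<rat>" for K zs c d z
  proof -
    obtain c' d' where K: "K = {c'..d'} \<inter> span_params zs" "c' \<in> \<rat>" "d' \<in> \<rat>" using \<open>K \<in> B zs\<close> by (auto simp: B_def)
    have "K \<inter> {c..d} \<inter> span_params (zs @ [z]) = {max c c'..min d d'} \<inter> span_params (zs @ [z])" using span_params_snoc[of zs z] unfolding K by auto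
    moreover have "max c c' \<in> \<rat>" "min d d' \<in> \<rat>" using K that by (auto simp: max_def min_def)
    ultimately show ?thesis unfolding B_def by blast
  qed
  have D: "H \<subseteq> block_seqs" "\<forall>Z\<in>H. \<forall>n. tail_above Z n \<in> H"
    using H_block_seq H_tail_above by (auto simp: block_seqs_def)
  from decide_uncountable[OF D cBB X]
  obtain Y W where Y: "Y \<in> H" "bpreceq Y X" "countable W" and
    big': "\<forall>zs\<in>lists Evec. \<forall>K\<in>BB. \<forall>b\<in>extendable_params H zs Y \<inter> K - W. \<forall>Y'\<in>H. bpreceq Y' Y \<longrightarrow> uncountable (extendable_params H zs Y' \<inter> K)"
    by (elim bexE conjE exE) (rule that)
  have big: "uncountable (extendable_params H zs Y' \<inter> K)"
    if "zs \<in> lists Evec" "K \<in> BB" "b \<in> extendable_params H zs Y" "b \<in> K" "b \<notin> W" "Y' \<in> H" "bpreceq Y' Y" for zs K b Y'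
    using big' that by blast
  obtain c0 d0 where "Q \<subseteq> {c0..d0}" using Q bounded_subset_cbox_symmetric[of Q]
    by (metis box_real(2) compact_imp_bounded)
  obtain c1 where c1: "c1 \<in> \<rat>" "c1 < c0" using Rats_dense_in_real[of "c0 - 1" c0] by auto
  obtain d1 where d1: "d1 \<in> \<rat>" "d0 < d1" using Rats_dense_in_real[of d0 "d0 + 1"] by auto
  \<comment> \<open>The root: a rational interval around \<open>Q\<close>, so that no parameter is
    lost at the start.\<close>
  define K0 where "K0 = {c1..d1} \<inter> span_params []"
  have K0: "K0 \<in> B []" using c1 d1 by (auto simp: K0_def B_def)
  have "span_params [] \<subseteq> {c1..d1}" using \<open>Q \<subseteq> {c0..d0}\<close> c1 d1 by (force simp: span_params_def)
  then have MK0: "extendable_params H [] Y' \<inter> K0 = extendable_params H [] Y'" for Y' using extendable_params_subset[of H "[]" Y'] unfolding K0_def by blast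
  \<comment> \<open>A state is a position together with the current level of the Cantor
    scheme.\<close>
  define S where "S = {(zs, U). zs \<in> lists Evec \<and> finite U \<and> U \<subseteq> B zs \<and>
     (\<forall>K\<in>U. \<forall>Y'\<in>H. bpreceq Y' Y \<longrightarrow> uncountable (extendable_params H zs Y' \<inter> K))}"
  define good where "good n l r U \<longleftrightarrow>
     (\<forall>K\<in>U. l K \<subseteq> K \<and> r K \<subseteq> K \<and> l K \<inter> r K = {} \<and>
       (\<forall>x\<in>l K. \<forall>y\<in>l K. dist x y \<le> 1 / Suc n) \<and> (\<forall>x\<in>r K. \<forall>y\<in>r K. dist x y \<le> 1 / Suc n))"
    for n l r and U :: "real set set"
  define step where "step s z s' \<longleftrightarrow> fst s' = fst s @ [z] \<and>
     (\<exists>l r. snd s' = l ` snd s \<union> r ` snd s \<and> good (length (fst s)) l r (snd s))"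
    for s s' :: "(nat \<Rightarrow> 'f) list \<times> real set set" and z
  obtain Z ss where Z: "Z \<in> H" "bpreceq Z Y" "ss 0 = ([], {K0})" and
    ss: "\<And>k. ss k \<in> S \<and> step (ss k) (Z k) (ss (Suc k))"
  proof (rule strategic_run[OF Y(1), of S "([], {K0})" step])
    have "S \<subseteq> lists Evec \<times> {U. finite U \<and> U \<subseteq> BB}" by (auto simp: S_def BB_def)
    moreover have "countable (lists (Evec :: (nat \<Rightarrow> 'f) set) \<times> {U. finite U \<and> U \<subseteq> BB})"
      using countable_Evec cBB countable_Collect_finite_subset by blast
    ultimately show "countable S" using countable_subset by blast
    show "([], {K0}) \<in> S" using unc Y(2) bpreceq_trans K0 by (auto simp: S_def MK0)
  next
    fix s Y' assume s: "s \<in> S" "Y' \<in> H" "bpreceq Y' Y"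
    obtain zs U where sU: "s = (zs, U)" by force
    have zsU: "zs \<in> lists Evec" "finite U" "U \<subseteq> B zs"
      using s by (auto simp: S_def sU)
    have unc: "uncountable (extendable_params H zs Y'' \<inter> K)" if "K \<in> U" "Y'' \<in> H" "bpreceq Y'' Y'" for K Y''
      using s(1) that bpreceq_trans[OF that(3) s(3)] by (auto simp: S_def sU)
    obtain Z f g where Z: "Z \<in> H" "bpreceq Z Y'" and
      fg: "\<And>K. K \<in> U \<Longrightarrow> f K \<noteq> g K"
        "\<And>K b. K \<in> U \<Longrightarrow> b \<in> {f K, g K} \<Longrightarrow> b \<in> K - W \<and> b \<in> Q \<and> (\<forall>v\<in>vs.span (set zs). \<forall>w\<in>span_of Z. G b (v + w))"
      using two_points_each[OF zsU(2) Y(3) s(2) unc] by blast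
    let ?z = "Z 0"
    have bZ: "block_seq Z" using Z H_block_seq by blast
    have ev: "zs @ [?z] \<in> lists Evec" using zsU bZ by (auto simp: block_seq_def)
    have bM: "b \<in> extendable_params H (zs @ [?z]) Y" if "K \<in> U" "b \<in> {f K, g K}" for K b
      using extendable_params_snocI[OF _ Z(1) bpreceq_trans[OF Z(2) s(3)] _ span_of_base] fg(2)[OF that] by blast
    have "\<exists>A A'. A \<in> B (zs @ [?z]) \<and> A' \<in> B (zs @ [?z]) \<and> f K \<in> A \<and> g K \<in> A' \<and> A \<subseteq> K \<and> A' \<subseteq> K \<and> A \<inter> A' = {} \<and>
       (\<forall>x\<in>A. \<forall>y\<in>A. dist x y \<le> 1 / Suc (length zs)) \<and> (\<forall>x\<in>A'. \<forall>y\<in>A'. dist x y \<le> 1 / Suc (length zs))"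
      if K: "K \<in> U" for K
    proof -
      \<comment> \<open>Intervals of diameter at most a third of the distance, one around each
        chosen parameter, are disjoint; the other bound is the mesh of the new level.\<close>
      define e where "e = min (1 / Suc (length zs)) (dist (f K) (g K) / 3)"
      have e: "e > 0" using fg(1)[OF K] by (simp add: e_def)
      obtain c d where cd: "c \<in> \<rat>" "d \<in> \<rat>" "c < f K" "f K < d" "\<And>x y. x \<in> {c..d} \<Longrightarrow> y \<in> {c..d} \<Longrightarrow> dist x y \<le> e"
        using rational_interval[OF e] by blast
      obtain c' d' where cd': "c' \<in> \<rat>" "d' \<in> \<rat>" "c' < g K" "g K < d'" "\<And>x y. x \<in> {c'..d'} \<Longrightarrow> y \<in> {c'..d'} \<Longrightarrow> dist x y \<le> e"
        using rational_interval[OF e] by blast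
      have dj: "{c..d} \<inter> {c'..d'} = {}"
      proof (rule ccontr)
        assume "{c..d} \<inter> {c'..d'} \<noteq> {}"
        then obtain x where "x \<in> {c..d}" "x \<in> {c'..d'}" by blast
        then have "dist (f K) x \<le> e" "dist x (g K) \<le> e" using cd cd' by auto
        then have "dist (f K) (g K) \<le> 2 * e" using dist_triangle[of "f K" "g K" x] by linarith
        moreover have "3 * e \<le> dist (f K) (g K)" by (simp add: e_def)
        ultimately show False using e by linarith
      qed
      have CC: "f K \<in> span_params (zs @ [?z])" "g K \<in> span_params (zs @ [?z])" using bM[OF K] extendable_params_subset by blast+
      have KB: "K \<in> B zs" using zsU K by blast
      have KK: "f K \<in> K" "g K \<in> K" using fg(2)[OF K] by auto
      have e1: "e \<le> 1 / Suc (length zs)" by (simp add: e_def)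
      show ?thesis
        apply (rule exI[of _ "K \<inter> {c..d} \<inter> span_params (zs @ [?z])"], rule exI[of _ "K \<inter> {c'..d'} \<inter> span_params (zs @ [?z])"])
        using B_step[OF KB cd(1,2)] B_step[OF KB cd'(1,2)] CC KK dj cd(3,4) cd'(3,4)
          order_trans[OF cd(5) e1] order_trans[OF cd'(5) e1]
        by auto
    qed
    then obtain l r where lr: "\<And>K. K \<in> U \<Longrightarrow> l K \<in> B (zs @ [?z]) \<and> r K \<in> B (zs @ [?z]) \<and> f K \<in> l K \<and> g K \<in> r K \<and> l K \<subseteq> K \<and> r K \<subseteq> K \<and> l K \<inter> r K = {} \<and>
       (\<forall>x\<in>l K. \<forall>y\<in>l K. dist x y \<le> 1 / Suc (length zs)) \<and> (\<forall>x\<in>r K. \<forall>y\<in>r K. dist x y \<le> 1 / Suc (length zs))"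
      by metis
    define U' where "U' = l ` U \<union> r ` U"
    \<comment> \<open>Each new piece contains one of the chosen parameters, which lies outside
      \<open>W\<close>, so \<open>big\<close> applies to it.\<close>
    have "uncountable (extendable_params H (zs @ [?z]) Y'' \<inter> L)" if L: "L \<in> U'" and Y'': "Y'' \<in> H" "bpreceq Y'' Y" for L Y''
    proof -
      obtain K b where K: "K \<in> U" "b \<in> {f K, g K}" "b \<in> L" using L lr unfolding U'_def by blast
      have "L \<in> B (zs @ [?z])" using L lr unfolding U'_def by blast
      then have "L \<in> BB" using ev unfolding BB_def by blast
      then show ?thesis using big[OF ev _ bM[OF K(1,2)] K(3) _ Y''] fg(2)[OF K(1,2)] by blast
    qed
    then have "(zs @ [?z], U') \<in> S" using ev zsU lr by (auto simp: S_def U'_def)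
    moreover have "step s ?z (zs @ [?z], U')"
      unfolding step_def good_def sU fst_conv snd_conv U'_def
      by (intro conjI refl exI[of _ l] exI[of _ r] ballI) (use lr in simp_all)
    moreover have "?z \<in> span_of Y'" "?z \<noteq> 0" using Z(2) bZ by (auto simp: bpreceq_iff block_seq_def supp_eq_empty_iff)
    ultimately show "\<exists>z\<in>span_of Y'. z \<noteq> 0 \<and> (\<exists>s'\<in>S. step s z s')" by blast
  qed (use that in blast)
  have zs: "fst (ss k) = map Z [0..<k]" for k by (induct k) (use Z ss in \<open>auto simp: step_def\<close>)
  define U where "U k = snd (ss k)" for k
  have "\<exists>l r. U (Suc k) = l ` U k \<union> r ` U k \<and> good k l r (U k)" for k
    using ss[of k] zs by (auto simp: step_def U_def)
  then obtain l r where lr: "\<And>k. U (Suc k) = l k ` U k \<union> r k ` U k" "\<And>k. good k (l k) (r k) (U k)" by metis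
  have UB: "U k \<subseteq> B (map Z [0..<k])" "map Z [0..<k] \<in> lists Evec" "\<And>K. K \<in> U k \<Longrightarrow> uncountable (extendable_params H (map Z [0..<k]) Y \<inter> K)" for k
    using ss[of k] zs[of k] Y(1) bpreceq_refl[of Y] by (auto simp: S_def U_def)
  have U0: "U 0 = {K0}" using Z by (simp add: U_def)
  have UK: "compact K" "K \<noteq> {}" if "K \<in> U k" for k K
  proof -
    show "compact K" using that UB(1,2)[of k] B_compact by blast
    show "K \<noteq> {}" using UB(3)[OF that] by auto
  qed
  define P where "P = (\<Inter>n. \<Union>(U n))"
  have *: "compact K0" "K0 \<noteq> {}" using UK[of K0 0] U0 by auto
  have lrU: "l k K \<in> U (Suc k)" "r k K \<in> U (Suc k)" if "K \<in> U k" for k K using that lr(1) by auto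
  have lrK: "l k K \<subseteq> K" "r k K \<subseteq> K" "l k K \<inter> r k K = {}" if "K \<in> U k" for k K
    using that lr(2)[of k] by (auto simp: good_def)
  have diam: "dist x y \<le> 1 / Suc k" if "K \<in> U (Suc k)" "x \<in> K" "y \<in> K" for k K x y
    using that lr(2)[of k] unfolding lr(1) good_def by blast
  have lrc: "compact (l k K)" "compact (r k K)" "l k K \<noteq> {}" "r k K \<noteq> {}" if "K \<in> U k" for k K
    using UK[OF lrU(1)[OF that]] UK[OF lrU(2)[OF that]] by simp_all
  have cs: "perf P"
    unfolding P_def by (rule cantor_scheme(1)[of U K0 l r]) (fact U0 | fact * | fact lr(1) | fact lrK | fact lrc | fact diam)+
  have PC: "P \<subseteq> span_params (map Z [0..<k])" for k
    unfolding P_def using UB(1)[of k] B_C by blast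
  have "P \<subseteq> Q" using PC[of 0] by (auto simp: span_params_def)
  moreover have "G b v" if "b \<in> P" "v \<in> span_of Z" for b v
  proof -
    obtain k where "v \<in> vs.span (set (map Z [0..<k]))" using span_of_initial[OF \<open>v \<in> span_of Z\<close>] .
    then show ?thesis using PC[of k] \<open>b \<in> P\<close> by (auto simp: span_params_def)
  qed
  ultimately show ?thesis using cs Z bpreceq_trans[OF Z(2) Y(2)] by blast
qed

end

text \<open>If uncountably many parameters always have a witness in \<open>H\<close>,
  \<open>perfect_parameters\<close> applies. Otherwise below some \<open>Y\<close> only countably
  many have one, and these are discarded. By the contrapositive of \<open>single_parameter\<close>,
  below some further sequence only countably many of the remaining ones have any block sequence as
  witness, and these are discarded as well.\<close>

theorem parametrised_fullness:
  assumes Q: "perf Q" and X: "X \<in> H"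
    and cl: "\<And>z. z \<in> Evec \<Longrightarrow> closed {b\<in>Q. G b z}"
  obtains P Z where "perf P" "P \<subseteq> Q" "Z \<in> H" "bpreceq Z X" "\<And>b. b \<in> P \<Longrightarrow> span_of Z \<subseteq> {z. G b z}"
  | P Y where "perf P" "P \<subseteq> Q" "Y \<in> H" "bpreceq Y X"
      "\<And>b Z. b \<in> P \<Longrightarrow> block_seq Z \<Longrightarrow> bpreceq Z Y \<Longrightarrow> \<not> span_of Z \<subseteq> {z. G b z}"
proof -
  have cQ: "compact Q" using Q by (simp add: perf_def)
  show ?thesis
  proof (cases "\<forall>Y. Y \<in> H \<longrightarrow> bpreceq Y X \<longrightarrow> uncountable (extendable_params G Q H [] Y)")
    case True
    have "\<exists>P\<subseteq>Q. perf P \<and> (\<exists>Z\<in>H. bpreceq Z X \<and> (\<forall>b\<in>P. span_of Z \<subseteq> {z. G b z}))"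
      by (rule perfect_parameters[OF cQ _ X]) (use cl True in auto)
    then show ?thesis using that(1) by blast
  next
    case False
    then obtain Y where Y: "Y \<in> H" "bpreceq Y X" "countable (extendable_params G Q H [] Y)" by blast
    obtain R where R: "perf R" "R \<subseteq> Q" "R \<inter> extendable_params G Q H [] Y = {}" using perf_avoid_countable[OF Q Y(3)] .
    have clR: "closed {b\<in>R. G b z}" if "z \<in> Evec" for z
    proof -
      have "{b\<in>R. G b z} = R \<inter> {b\<in>Q. G b z}" using R by blast
      then show ?thesis using cl[OF that] R by (simp add: perf_def compact_imp_closed closed_Int)
    qed
    have noH: "\<not> (\<exists>b\<in>R. \<exists>Z\<in>H. bpreceq Z Y \<and> span_of Z \<subseteq> {z. G b z})"
    proof -
      have "extendable_params G Q H [] Y = {b\<in>Q. \<exists>Z\<in>H. bpreceq Z Y \<and> span_of Z \<subseteq> {z. G b z}}"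
        by (rule extendable_params_Nil) (use cQ cl in auto)
      then show ?thesis using R by blast
    qed
    have cR: "compact R" using R by (simp add: perf_def)
    have "\<exists>Y'\<in>H. bpreceq Y' Y \<and> countable (extendable_params G R block_seqs [] Y')"
    proof (rule ccontr)
      assume "\<not> ?thesis"
      then have "\<exists>b\<in>R. \<exists>Z\<in>H. bpreceq Z Y \<and> span_of Z \<subseteq> {z. G b z}"
        by (intro single_parameter[OF cR _ Y(1)]) (use clR in auto)
      with noH show False by blast
    qed
    then obtain Y' where Y': "Y' \<in> H" "bpreceq Y' Y" "countable (extendable_params G R block_seqs [] Y')" by blast
    obtain P where P: "perf P" "P \<subseteq> R" "P \<inter> extendable_params G R block_seqs [] Y' = {}" using perf_avoid_countable[OF R(1) Y'(3)] .
    have Mnil: "extendable_params G R block_seqs [] Y' = {b\<in>R. \<exists>Z\<in>block_seqs. bpreceq Z Y' \<and> span_of Z \<subseteq> {z. G b z}}"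
      by (rule extendable_params_Nil) (use cR clR in auto)
    show ?thesis
    proof (rule that(2)[OF P(1) _ Y'(1) bpreceq_trans[OF Y'(2) Y(2)]])
      show "P \<subseteq> Q" using P R by blast
      fix b Z assume "b \<in> P" "block_seq Z" "bpreceq Z Y'"
      then show "\<not> span_of Z \<subseteq> {z. G b z}"
        using P Mnil by (auto simp: block_seqs_def)
    qed
  qed
qed

end

section \<open>Games open for II\<close>

text \<open>As a least fixed point it lets II force \<open>T\<close> in finitely many moves, without
  a bound fixed in advance. Block position is not demanded of \<open>z\<close>: it is obtained by
  applying the clause to tails of \<open>Z\<close>.\<close>

inductive reach :: "(nat \<Rightarrow> nat \<Rightarrow> 'f::field) \<Rightarrow> ((nat \<Rightarrow> 'f) list \<Rightarrow> bool) \<Rightarrow> (nat \<Rightarrow> 'f) list \<Rightarrow> bool"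
  for X T where
  reach_target: "T ws \<Longrightarrow> reach X T ws"
| reach_move: "(\<And>Z. block_seq Z \<Longrightarrow> bpreceq Z X \<Longrightarrow> \<exists>z\<in>span_of Z. z \<noteq> 0 \<and> reach X T (ws @ [z])) \<Longrightarrow> reach X T ws"

lemma reach_mono:
  assumes "reach X T ws" "block_seq X" "block_seq X'" "bpreceq_star X' X"
  shows "reach X' T ws"
  using assms(1)
proof induct
  case (reach_move ws)
  show ?case
  proof (rule reach.reach_move)
    fix Z assume Z: "block_seq Z" "bpreceq Z X'"
    obtain n where "bpreceq (tail_above Z n) X" using bpreceq_star_tail[OF assms(3) Z(1) assms(4) Z(2)] .
    from reach_move(1)[OF block_seq_tail_above[OF Z(1)] this]
    show "\<exists>z\<in>span_of Z. z \<noteq> 0 \<and> reach X' T (ws @ [z])"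
      using bpreceq_tail_above[OF Z(1), of n] by (auto simp: bpreceq_def)
  qed
qed (rule reach.reach_target)

text \<open>Play from a position of length \<open>n\<close>: the first \<open>n\<close> vectors are
  already given and bound only by \<open>block_seq\<close>.\<close>

definition follows :: "((nat \<Rightarrow> 'f) list \<Rightarrow> nat) \<Rightarrow> (nat \<Rightarrow> nat \<Rightarrow> 'f::field) \<Rightarrow> nat \<Rightarrow> (nat \<Rightarrow> nat \<Rightarrow> 'f) \<Rightarrow> bool" where
  "follows \<sigma> X n W \<longleftrightarrow> block_seq W \<and> (\<forall>k\<ge>n. W k \<in> span_of X \<and> \<sigma> (map W [0..<k]) < Min (supp (W k)))"

text \<open>Larger moves of I restrict II more, so I can obey several strategies by taking
  maxima.\<close>

lemma follows_mono:
  assumes "follows \<sigma> X m W" "m \<le> n" "\<And>k. n \<le> k \<Longrightarrow> \<tau> (map W [0..<k]) \<le> \<sigma> (map W [0..<k])"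
  shows "follows \<tau> X n W"
  using assms unfolding follows_def by (meson le_less_trans order_trans)

text \<open>Vectors of \<open>X'\<close> above a suitable \<open>N\<close> lie in the span of
  \<open>X\<close>; I raises every move to at least \<open>N\<close>.\<close>

lemma follows_star:
  assumes X: "block_seq X" "block_seq X'" and "bpreceq_star X' X"
  obtains N where "\<And>\<sigma> n W. follows (\<lambda>ws. max N (\<sigma> ws)) X' n W \<Longrightarrow> follows \<sigma> X n W"
proof -
  obtain N where N: "\<forall>v\<in>span_of X'. above N v \<longrightarrow> v \<in> span_of X"
    using assms by (auto simp: bpreceq_star_iff)
  show ?thesis
  proof (rule that[of N])
    fix \<sigma> n W assume W: "follows (\<lambda>ws. max N (\<sigma> ws)) X' n W"
    have "W k \<in> span_of X" if "n \<le> k" for k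
    proof -
      have "W k \<in> span_of X'" "N < Min (supp (W k))" "supp (W k) \<noteq> {}"
        using W that by (auto simp: follows_def block_seq_def)
      then show ?thesis using N above_iff_Min[OF X(2), of "W k"] by blast
    qed
    then show "follows \<sigma> X n W" using W by (auto simp: follows_def)
  qed
qed

context strategic_p_plus
begin

text \<open>The forcing negation of \<open>\<Gamma>\<close>. Unlike plain failure of
  \<open>\<Gamma>\<close> it is hereditary, so it can be decided by fusion.\<close>

definition dead :: "(real set \<Rightarrow> (nat \<Rightarrow> nat \<Rightarrow> 'f) \<Rightarrow> bool) \<Rightarrow> real set \<Rightarrow> (nat \<Rightarrow> nat \<Rightarrow> 'f) \<Rightarrow> bool" where
  "dead \<Gamma> R Y \<longleftrightarrow> (\<forall>R' Z. perf R' \<longrightarrow> R' \<subseteq> R \<longrightarrow> Z \<in> H \<longrightarrow> bpreceq Z Y \<longrightarrow> \<not> \<Gamma> R' Z)"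

lemma decide_locally:
  assumes I: "countable I"
    and her: "\<And>i R Y R' Y'. i \<in> I \<Longrightarrow> \<Gamma> i R Y \<Longrightarrow> R' \<subseteq> R \<Longrightarrow> Y \<in> H \<Longrightarrow> Y' \<in> H \<Longrightarrow> bpreceq_star Y' Y \<Longrightarrow> \<Gamma> i R' Y'"
    and Q: "perf Q" and X: "X \<in> H"
  shows "\<exists>P Y. perf P \<and> P \<subseteq> Q \<and> Y \<in> H \<and> bpreceq Y X \<and>
    (\<forall>i\<in>I. \<forall>t\<in>P. \<exists>V. open V \<and> t \<in> V \<and> (\<Gamma> i (P \<inter> V) Y \<or> dead (\<Gamma> i) (P \<inter> V) Y))"
proof (rule fusion[OF I _ _ Q X])
  fix i R Y R' Y' assume a: "i \<in> I" "\<Gamma> i R Y \<or> dead (\<Gamma> i) R Y" "R' \<subseteq> R" "Y \<in> H" "Y' \<in> H" "bpreceq_star Y' Y"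
  have "dead (\<Gamma> i) R' Y'" if d: "dead (\<Gamma> i) R Y"
    unfolding dead_def
  proof (intro allI impI notI)
    fix R'' Z assume Z: "perf R''" "R'' \<subseteq> R'" "Z \<in> H" "bpreceq Z Y'" "\<Gamma> i R'' Z"
    obtain n where n: "bpreceq (tail_above Z n) Y" using bpreceq_star_tail[OF _ _ a(6) Z(4)] H_block_seq Z a by blast
    have "\<Gamma> i R'' (tail_above Z n)"
      by (rule her[OF a(1) Z(5) subset_refl Z(3) H_tail_above[OF Z(3)]])
        (intro bpreceq_imp_star bpreceq_tail_above block_seq_tail_above H_block_seq Z)+
    moreover have "R'' \<subseteq> R" using Z a by blast
    ultimately show False using d Z(1) n H_tail_above[OF Z(3)] unfolding dead_def by blast
  qed
  with a her[OF a(1) _ a(3-6)] show "\<Gamma> i R' Y' \<or> dead (\<Gamma> i) R' Y'" by blast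
next
  fix i R Y assume "perf R" "Y \<in> H"
  show "\<exists>R' Y'. perf R' \<and> R' \<subseteq> R \<and> Y' \<in> H \<and> bpreceq Y' Y \<and> (\<Gamma> i R' Y' \<or> dead (\<Gamma> i) R' Y')"
  proof (cases "dead (\<Gamma> i) R Y")
    case True
    with \<open>perf R\<close> \<open>Y \<in> H\<close> bpreceq_refl show ?thesis by blast
  next
    case False
    then show ?thesis unfolding dead_def by blast
  qed
qed

text \<open>Neither \<open>P \<inter> V\<close> nor \<open>R \<inter> V'\<close> has to be perfect,
  so the contradiction is drawn from a perfect subset of both.\<close>

lemma dead_locally:
  assumes "dead \<Gamma> (P \<inter> V) Y" and her: "\<And>R R'. \<Gamma> R Z \<Longrightarrow> R' \<subseteq> R \<Longrightarrow> \<Gamma> R' Z"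
    and "perf R" "R \<subseteq> P" "t \<in> R" "open V" "t \<in> V" "open V'" "t \<in> V'" "Z \<in> H" "bpreceq Z Y"
  shows "\<not> \<Gamma> (R \<inter> V') Z"
proof
  assume g: "\<Gamma> (R \<inter> V') Z"
  have "open (V \<inter> V')" "t \<in> V \<inter> V'" using assms by auto
  then obtain R' where "perf R'" "R' \<subseteq> R \<inter> (V \<inter> V')" using perf_nbhd[OF assms(3) _ assms(5)] by metis
  moreover from this have "\<Gamma> R' Z" by (intro her[OF g]) auto
  ultimately show False using assms unfolding dead_def by blast
qed

text \<open>As in the determinacy of open games, I avoids live positions. For a position
  \<open>ws\<close>, \<open>parametrised_fullness\<close> is applied to the vectors whose addition
  is not live: either a whole span consists of them, or every span contains a live answer and II can
  already force \<open>T\<close> from \<open>ws\<close>.\<close>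

theorem open_game:
  assumes Q: "perf Q" and X: "X \<in> H" and ys: "ys \<in> lists Evec"
    and T_open: "\<And>t ws. t \<in> Q \<Longrightarrow> ws \<in> lists Evec \<Longrightarrow> T t ws \<Longrightarrow> \<exists>V. open V \<and> t \<in> V \<and> (\<forall>u\<in>Q \<inter> V. T u ws)"
  shows "\<exists>P Y. perf P \<and> P \<subseteq> Q \<and> Y \<in> H \<and> bpreceq Y X \<and>
    ((\<forall>t\<in>P. reach Y (T t) ys) \<or>
     (\<exists>\<sigma>. \<forall>t\<in>P. \<forall>W. follows \<sigma> Y (length ys) W \<longrightarrow> map W [0..<length ys] = ys \<longrightarrow>
        (\<forall>k\<ge>length ys. \<not> T t (map W [0..<k]))))"
proof -
  define \<Gamma> where "\<Gamma> ws R Y \<longleftrightarrow> (\<forall>t\<in>R. reach Y (T t) ws)" for ws R Y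
  have her: "\<Gamma> ws R' Y'" if "\<Gamma> ws R Y" "R' \<subseteq> R" "Y \<in> H" "Y' \<in> H" "bpreceq_star Y' Y" for ws R Y R' Y'
    using that H_block_seq unfolding \<Gamma>_def by (blast intro: reach_mono)
  have her': "\<Gamma> ws R' Y" if "\<Gamma> ws R Y" "R' \<subseteq> R" for ws R Y R' using that by (auto simp: \<Gamma>_def)
  have cI: "countable (lists (Evec :: (nat \<Rightarrow> 'f) set))" by (intro countable_lists countable_Evec)
  have "\<exists>P1 X1. perf P1 \<and> P1 \<subseteq> Q \<and> X1 \<in> H \<and> bpreceq X1 X \<and>
    (\<forall>ws\<in>lists Evec. \<forall>t\<in>P1. \<exists>V. open V \<and> t \<in> V \<and> (\<Gamma> ws (P1 \<inter> V) X1 \<or> dead (\<Gamma> ws) (P1 \<inter> V) X1))"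
    by (rule decide_locally[OF cI her Q X])
  then obtain P1 X1 where 1: "perf P1" "P1 \<subseteq> Q" "X1 \<in> H" "bpreceq X1 X"
    and dec: "\<And>ws t. ws \<in> lists Evec \<Longrightarrow> t \<in> P1 \<Longrightarrow> \<exists>V. open V \<and> t \<in> V \<and> (\<Gamma> ws (P1 \<inter> V) X1 \<or> dead (\<Gamma> ws) (P1 \<inter> V) X1)"
    by metis
  \<comment> \<open>Asking for a whole neighbourhood makes this open in \<open>t\<close>, so that
    the set handed to \<open>parametrised_fullness\<close> is closed.\<close>
  define live where "live ws t \<longleftrightarrow> (\<exists>V. open V \<and> t \<in> V \<and> \<Gamma> ws (P1 \<inter> V) X1)" for ws t
  have not_live: "\<not> \<Gamma> ws (R \<inter> V) Z"
    if "ws \<in> lists Evec" "\<not> live ws t" "perf R" "R \<subseteq> P1" "t \<in> R" "open V" "t \<in> V" "Z \<in> H" "bpreceq Z X1" for ws t R V Z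
  proof -
    note a = that
    obtain V' where V': "open V'" "t \<in> V'" "dead (\<Gamma> ws) (P1 \<inter> V') X1"
      using dec[OF a(1), of t] a(2,4,5) unfolding live_def by blast
    show ?thesis by (rule dead_locally[OF V'(3) her' a(3-5) V'(1,2) a(6-9)])
  qed
  show ?thesis
  proof (cases "\<exists>t\<in>P1. live ys t")
    case True
    then obtain t V where t: "t \<in> P1" "open V" "t \<in> V" "\<Gamma> ys (P1 \<inter> V) X1" by (auto simp: live_def)
    obtain R where R: "perf R" "R \<subseteq> P1 \<inter> V" using perf_nbhd[OF 1(1) t(2,1,3)] .
    then have "\<forall>t\<in>R. reach X1 (T t) ys" using t(4) by (auto simp: \<Gamma>_def)
    then show ?thesis using R 1 by blast
  next
    case False
    \<comment> \<open>The threshold \<open>n\<close> makes the second clause survive the passage to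
      a sequence that is smaller only modulo finite.\<close>
    define K where "K ws R Y \<longleftrightarrow> \<Gamma> ws R Y \<or>
      (\<exists>n. \<forall>t\<in>R. \<forall>z\<in>span_of Y. z \<noteq> 0 \<longrightarrow> above n z \<longrightarrow> \<not> live (ws @ [z]) t)" for ws R Y
    have "\<exists>P2 X2. perf P2 \<and> P2 \<subseteq> P1 \<and> X2 \<in> H \<and> bpreceq X2 X1 \<and>
      (\<forall>ws\<in>lists Evec. \<forall>t\<in>P2. \<exists>V. open V \<and> t \<in> V \<and> K ws (P2 \<inter> V) X2)"
    proof (rule fusion[OF cI _ _ 1(1,3)])
      fix ws R Y R' Y'
      assume a: "K ws R Y" "R' \<subseteq> R" "Y \<in> H" "Y' \<in> H" "bpreceq_star Y' Y"
      obtain m where m: "\<forall>v\<in>span_of Y'. above m v \<longrightarrow> v \<in> span_of Y"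
        using a(5) bpreceq_star_iff[OF H_block_seq[OF a(4)]] by blast
      show "K ws R' Y'"
      proof (cases "\<Gamma> ws R Y")
        case True
        then show ?thesis using her[OF True a(2-5)] by (simp add: K_def)
      next
        case False
        then obtain n where n: "\<forall>t\<in>R. \<forall>z\<in>span_of Y. z \<noteq> 0 \<longrightarrow> above n z \<longrightarrow> \<not> live (ws @ [z]) t"
          using a(1) by (auto simp: K_def)
        have "\<forall>t\<in>R'. \<forall>z\<in>span_of Y'. z \<noteq> 0 \<longrightarrow> above (max m n) z \<longrightarrow> \<not> live (ws @ [z]) t"
          using n m a(2) above_mono[OF _ max.cobounded1] above_mono[OF _ max.cobounded2] by blast
        then show ?thesis unfolding K_def by blast
      qed
    next
      \<comment> \<open>In the set defined next, 0 counts as not live: every span contains it, and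
        II may not play it.\<close>
      fix ws R Y assume a: "perf R" "R \<subseteq> P1" "Y \<in> H" "bpreceq Y X1"
      define G where "G b z \<longleftrightarrow> z = 0 \<or> \<not> live (ws @ [z]) b" for b z
      have cl: "closed {b\<in>R. G b z}" for z
      proof (cases "z = 0")
        case False
        have "{b\<in>R. G b z} = R - \<Union>{V. open V \<and> \<Gamma> (ws @ [z]) (P1 \<inter> V) X1}"
          using False by (auto simp: G_def live_def)
        moreover have "closed R" using a(1) by (simp add: perf_def compact_imp_closed)
        moreover have "open (\<Union>{V. open V \<and> \<Gamma> (ws @ [z]) (P1 \<inter> V) X1})" by (rule open_Union) simp
        ultimately show ?thesis by (simp add: closed_Diff)
      qed (use a(1) in \<open>simp add: G_def perf_def compact_imp_closed\<close>)
      show "\<exists>R' Y'. perf R' \<and> R' \<subseteq> R \<and> Y' \<in> H \<and> bpreceq Y' Y \<and> K ws R' Y'"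
      proof (rule parametrised_fullness[OF a(1,3) cl])
        fix P Z assume PZ: "perf P" "P \<subseteq> R" "Z \<in> H" "bpreceq Z Y" "\<And>b. b \<in> P \<Longrightarrow> span_of Z \<subseteq> {z. G b z}"
        then have "\<forall>t\<in>P. \<forall>z\<in>span_of Z. z \<noteq> 0 \<longrightarrow> \<not> live (ws @ [z]) t" unfolding G_def by blast
        then have "K ws P Z" unfolding K_def by blast
        then show ?thesis using PZ by blast
      next
        fix P Y' assume P: "perf P" "P \<subseteq> R" "Y' \<in> H" "bpreceq Y' Y"
          and ns: "\<And>b Z. b \<in> P \<Longrightarrow> block_seq Z \<Longrightarrow> bpreceq Z Y' \<Longrightarrow> \<not> span_of Z \<subseteq> {z. G b z}"
        have "reach Y' (T t) ws" if t: "t \<in> P" for t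
        proof (rule reach_move)
          fix Z assume "block_seq Z" "bpreceq Z Y'"
          from ns[OF t this] obtain z where z: "z \<in> span_of Z" "z \<noteq> 0" "live (ws @ [z]) t" by (auto simp: G_def)
          then have "reach X1 (T t) (ws @ [z])" using t P(2) a(2) by (auto simp: live_def \<Gamma>_def)
          then have "reach Y' (T t) (ws @ [z])"
            using P a 1 by (meson H_block_seq bpreceq_imp_star bpreceq_trans reach_mono)
          with z show "\<exists>z\<in>span_of Z. z \<noteq> 0 \<and> reach Y' (T t) (ws @ [z])" by blast
        qed
        then have "K ws P Y'" by (simp add: K_def \<Gamma>_def)
        then show ?thesis using P by blast
      qed
    qed
    then obtain P2 X2 where 2: "perf P2" "P2 \<subseteq> P1" "X2 \<in> H" "bpreceq X2 X1"
      and K: "\<And>ws t. ws \<in> lists Evec \<Longrightarrow> t \<in> P2 \<Longrightarrow> \<exists>V. open V \<and> t \<in> V \<and> K ws (P2 \<inter> V) X2"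
      by metis
    define \<sigma> where "\<sigma> ws = (SOME n. \<forall>t\<in>P2. \<forall>m\<ge>n. \<forall>z\<in>span_of X2. z \<noteq> 0 \<longrightarrow> above m z \<longrightarrow> \<not> live (ws @ [z]) t)" for ws
    have \<sigma>: "\<not> live (ws @ [z]) t"
      if ws: "ws \<in> lists Evec" "\<forall>t\<in>P2. \<not> live ws t" and z: "t \<in> P2" "z \<in> span_of X2" "z \<noteq> 0" "above (\<sigma> ws) z" for ws z t
    proof -
      have "\<exists>n. \<forall>t\<in>P2. \<forall>m\<ge>n. \<forall>z\<in>span_of X2. z \<noteq> 0 \<longrightarrow> above m z \<longrightarrow> \<not> live (ws @ [z]) t"
      proof (rule compact_uniform_bound)
        show "compact P2" using 2(1) by (simp add: perf_def)
        fix t assume t: "t \<in> P2"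
        obtain V where V: "open V" "t \<in> V" "K ws (P2 \<inter> V) X2" using K[OF ws(1) t] by blast
        moreover have "\<not> \<Gamma> ws (P2 \<inter> V) X2"
          using not_live[OF ws(1) _ 2(1,2) t V(1,2) 2(3,4)] ws(2) t by blast
        ultimately obtain n where "\<forall>t\<in>P2 \<inter> V. \<forall>z\<in>span_of X2. z \<noteq> 0 \<longrightarrow> above n z \<longrightarrow> \<not> live (ws @ [z]) t"
          by (auto simp: K_def)
        then have "\<forall>u\<in>P2 \<inter> V. \<forall>m\<ge>n. \<forall>z\<in>span_of X2. z \<noteq> 0 \<longrightarrow> above m z \<longrightarrow> \<not> live (ws @ [z]) u"
          using above_mono by blast
        then show "\<exists>V n. open V \<and> t \<in> V \<and> (\<forall>u\<in>P2 \<inter> V. \<forall>m\<ge>n. \<forall>z\<in>span_of X2. z \<noteq> 0 \<longrightarrow> above m z \<longrightarrow> \<not> live (ws @ [z]) u)"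
          using V by blast
      qed
      then have "\<forall>t\<in>P2. \<forall>m\<ge>\<sigma> ws. \<forall>z\<in>span_of X2. z \<noteq> 0 \<longrightarrow> above m z \<longrightarrow> \<not> live (ws @ [z]) t"
        unfolding \<sigma>_def by (rule someI_ex)
      then show ?thesis using z by blast
    qed
    have "\<not> T t (map W [0..<k])"
      if t: "t \<in> P2" and W: "follows \<sigma> X2 (length ys) W" "map W [0..<length ys] = ys" and k: "length ys \<le> k" for t W k
    proof -
      have ev: "map W [0..<k] \<in> lists Evec" for k using W(1) by (auto simp: follows_def block_seq_def)
      from k have "\<forall>t\<in>P2. \<not> live (map W [0..<k]) t"
      proof (induct k rule: dec_induct)
        case base
        then show ?case using False 2(2) W(2) by auto
      next
        case (step k)
        have Wk: "W k \<in> span_of X2" "supp (W k) \<noteq> {}" "\<sigma> (map W [0..<k]) < Min (supp (W k))"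
          using W(1) step(1) by (auto simp: follows_def block_seq_def)
        then have "above (\<sigma> (map W [0..<k])) (W k)" using above_iff_Min[OF H_block_seq[OF 2(3)]] by blast
        then show ?case using \<sigma>[OF ev step(3)] Wk by (simp add: supp_eq_empty_iff)
      qed
      \<comment> \<open>By openness of the target, a position in it would be live, and I never lets
        one arise.\<close>
      moreover have "live (map W [0..<k]) t" if "T t (map W [0..<k])"
      proof -
        have "t \<in> Q" using t 1 2 by blast
        then obtain V where "open V" "t \<in> V" "\<forall>u\<in>Q \<inter> V. T u (map W [0..<k])" using T_open[OF _ ev \<open>T t _\<close>] by blast
        then show ?thesis unfolding live_def \<Gamma>_def using 1(2) reach_target by blast
      qed
      ultimately show ?thesis using t by blast
    qed
    then have "\<exists>\<sigma>. \<forall>t\<in>P2. \<forall>W. follows \<sigma> X2 (length ys) W \<longrightarrow> map W [0..<length ys] = ys \<longrightarrow>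
        (\<forall>k\<ge>length ys. \<not> T t (map W [0..<k]))" by blast
    moreover have "P2 \<subseteq> Q" "bpreceq X2 X" using 1 2 bpreceq_trans by blast+
    ultimately show ?thesis using 2 by blast
  qed
qed

end

section \<open>Analytic sets\<close>

text \<open>A well-founded strategy tree of II for reaching a target in finitely many moves; its height
  is what guarantees progress when such strategies are concatenated.\<close>
datatype 'f plan = Done | Step "(nat \<Rightarrow> nat \<Rightarrow> 'f) \<Rightarrow> (nat \<Rightarrow> 'f) \<times> 'f plan"

inductive winning :: "(nat \<Rightarrow> nat \<Rightarrow> 'f::field) \<Rightarrow> ((nat \<Rightarrow> 'f) list \<Rightarrow> bool) \<Rightarrow> 'f plan \<Rightarrow> (nat \<Rightarrow> 'f) list \<Rightarrow> bool"
  for X T where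
  winning_Done: "T ws \<Longrightarrow> winning X T Done ws"
| winning_Step: "(\<And>Z. block_seq Z \<Longrightarrow> bpreceq Z X \<Longrightarrow> fst (F Z) \<in> span_of Z \<and> fst (F Z) \<noteq> 0 \<and>
     winning X T (snd (F Z)) (ws @ [fst (F Z)])) \<Longrightarrow> winning X T (Step F) ws"

lemma reach_imp_winning: "reach X T ws \<Longrightarrow> \<exists>p. winning X T p ws"
proof (induct rule: reach.induct)
  case (reach_target ws)
  then show ?case using winning_Done by blast
next
  case (reach_move ws)
  then have "\<forall>Z. \<exists>q. block_seq Z \<longrightarrow> bpreceq Z X \<longrightarrow> fst q \<in> span_of Z \<and> fst q \<noteq> 0 \<and> winning X T (snd q) (ws @ [fst q])"
    by (metis fst_conv snd_conv)
  then obtain F where "\<And>Z. block_seq Z \<Longrightarrow> bpreceq Z X \<Longrightarrow>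
      fst (F Z) \<in> span_of Z \<and> fst (F Z) \<noteq> 0 \<and> winning X T (snd (F Z)) (ws @ [fst (F Z)])"
    by metis
  then show ?case using winning_Step[of X F T ws] by blast
qed

lemma baire_nbhd:
  assumes "openin baire_top U" "x \<in> U"
  shows "\<exists>n. \<forall>x'. map x' [0..<n] = map x [0..<n] \<longrightarrow> x' \<in> U"
proof -
  obtain V where V: "finite {i. V i \<noteq> UNIV}" "x \<in> Pi\<^sub>E UNIV V" "Pi\<^sub>E UNIV V \<subseteq> U"
    using assms unfolding baire_top_def openin_product_topology_alt by force
  obtain n where n: "{i. V i \<noteq> UNIV} \<subseteq> {..<n}" using V(1) by (metis finite_nat_iff_bounded)
  show ?thesis
  proof (intro exI allI impI)
    fix x' assume x': "map x' [0..<n] = map x [0..<n]"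
    have "x' i \<in> V i" for i
    proof (cases "i < n")
      case True
      then have "x' i = x i" using x' by (simp add: map_eq_conv)
      then show ?thesis using V(2) by auto
    next
      case False
      then have "V i = UNIV" using n by auto
      then show ?thesis by simp
    qed
    then show "x' \<in> U" using V(3) by auto
  qed
qed

section \<open>The dichotomy for continuous images of Baire space\<close>

locale parametrised_analytic = strategic_p_plus H
  for H :: "(nat \<Rightarrow> nat \<Rightarrow> 'f::{field,countable}) set" +
  fixes f :: "(nat \<Rightarrow> nat) \<Rightarrow> real \<times> (nat \<Rightarrow> nat \<Rightarrow> 'f)"
  assumes cont: "continuous_map baire_top (prod_topology euclideanreal Einf_top) f"
begin

text \<open>By continuity the values at \<open>x'\<close> approach \<open>f x\<close>, and by
  assumption they approach \<open>(t, Y)\<close>. The parameter varies too, because a bad position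
  only supplies points of the image with parameters near \<open>t\<close>.\<close>

lemma limit_point:
  assumes approx: "\<And>n e. e > 0 \<Longrightarrow> \<exists>x'. map x' [0..<n] = map x [0..<n] \<and> dist (fst (f x')) t < e \<and>
      map (snd (f x')) [0..<n] = map Y [0..<n]"
  shows "f x = (t, Y)"
proof -
  have top: "topspace baire_top = UNIV" by (simp add: baire_top_def)
  have c1: "continuous_map baire_top euclideanreal (fst \<circ> f)"
    and c2: "continuous_map baire_top Einf_top (snd \<circ> f)"
    using cont by (simp_all add: continuous_map_pairwise)
  have c3: "continuous_map baire_top (discrete_topology Evec) (\<lambda>x. snd (f x) k)" for k
    using c2 by (simp add: Einf_top_def continuous_map_in_subtopology continuous_map_componentwise_UNIV)
  have "fst (f x) = t"
  proof (rule ccontr)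
    assume "fst (f x) \<noteq> t"
    define e where "e = dist (fst (f x)) t / 2"
    have e: "e > 0" using \<open>fst (f x) \<noteq> t\<close> by (simp add: e_def)
    define U where "U = {z \<in> topspace baire_top. (fst \<circ> f) z \<in> ball (fst (f x)) e}"
    have "openin baire_top U" unfolding U_def by (rule openin_continuous_map_preimage[OF c1]) simp
    moreover have "x \<in> U" using e by (simp add: U_def top)
    ultimately have "\<exists>n. \<forall>x'. map x' [0..<n] = map x [0..<n] \<longrightarrow> x' \<in> U" by (rule baire_nbhd)
    then obtain n where n: "\<And>x'. map x' [0..<n] = map x [0..<n] \<Longrightarrow> x' \<in> U" by blast
    obtain x' where "map x' [0..<n] = map x [0..<n]" "dist (fst (f x')) t < e" using approx[OF e] by blast
    with n have "dist (fst (f x)) t < 2 * e"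
      using dist_triangle[of "fst (f x)" t "fst (f x')"] by (fastforce simp: U_def)
    then show False by (simp add: e_def)
  qed
  moreover have "snd (f x) k = Y k" for k
  proof -
    have "snd (f x) k \<in> Evec" using c3[of k] by (auto simp: continuous_map_def top)
    define U where "U = {z \<in> topspace baire_top. snd (f z) k \<in> {snd (f x) k}}"
    have "openin baire_top U" unfolding U_def
      by (intro openin_continuous_map_preimage[OF c3]) (simp add: \<open>snd (f x) k \<in> Evec\<close>)
    moreover have "x \<in> U" by (simp add: U_def top)
    ultimately have "\<exists>n. \<forall>x'. map x' [0..<n] = map x [0..<n] \<longrightarrow> x' \<in> U" by (rule baire_nbhd)
    then obtain n where n: "\<And>x'. map x' [0..<n] = map x [0..<n] \<Longrightarrow> x' \<in> U" by blast
    \<comment> \<open>\<open>n\<close> digits fix the vector with index \<open>k\<close> by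
      continuity; length \<open>Suc k\<close> makes it comparable with \<open>Y k\<close>.\<close>
    obtain x' where x': "map x' [0..<max n (Suc k)] = map x [0..<max n (Suc k)]"
      "map (snd (f x')) [0..<max n (Suc k)] = map Y [0..<max n (Suc k)]" using approx[OF zero_less_one] by blast
    then have "map x' [0..<n] = map x [0..<n]" "snd (f x') k = Y k" by (auto simp: map_eq_conv)
    then show ?thesis using n[of x'] by (simp add: U_def)
  qed
  ultimately show ?thesis by (metis ext prod.collapse)
qed

definition avoids :: "(nat \<Rightarrow> 'f) list \<times> nat list \<Rightarrow> real set \<Rightarrow> (nat \<Rightarrow> nat \<Rightarrow> 'f) \<Rightarrow> bool" where
  "avoids p R X = (case p of (ws, s) \<Rightarrow> \<exists>\<sigma>. \<forall>t\<in>R. \<forall>W x. follows \<sigma> X (length ws) W \<longrightarrow>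
     map W [0..<length ws] = ws \<longrightarrow> map x [0..<length s] = s \<longrightarrow> f x \<noteq> (t, W))"

lemma avoids_subset: "avoids p R X \<Longrightarrow> R' \<subseteq> R \<Longrightarrow> avoids p R' X"
  unfolding avoids_def by (cases p) blast

lemma avoids_mono:
  assumes "avoids p R X" "R' \<subseteq> R" "X \<in> H" "X' \<in> H" "bpreceq_star X' X"
  shows "avoids p R' X'"
proof -
  obtain ws s where p: "p = (ws, s)" by force
  obtain \<sigma> where \<sigma>: "\<forall>t\<in>R. \<forall>W x. follows \<sigma> X (length ws) W \<longrightarrow>
     map W [0..<length ws] = ws \<longrightarrow> map x [0..<length s] = s \<longrightarrow> f x \<noteq> (t, W)"
    using assms(1) by (auto simp: avoids_def p)
  obtain N where N: "\<And>\<sigma> n W. follows (\<lambda>ws. max N (\<sigma> ws)) X' n W \<Longrightarrow> follows \<sigma> X n W"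
    using follows_star[OF H_block_seq[OF assms(3)] H_block_seq[OF assms(4)] assms(5)] by metis
  show ?thesis unfolding avoids_def p prod.case
    by (rule exI[of _ "\<lambda>ws. max N (\<sigma> ws)"]) (use \<sigma> N assms(2) in blast)
qed

text \<open>The strategies of a finite subcover are merged by their maximum, which serves each of
  them by \<open>follows_mono\<close>; \<open>insert 0\<close> keeps \<open>Max\<close>
  meaningful.\<close>

lemma avoids_compact:
  assumes "compact R" and loc: "\<And>t. t \<in> R \<Longrightarrow> \<exists>V. open V \<and> t \<in> V \<and> avoids (ws, s) (R \<inter> V) X"
  shows "avoids (ws, s) R X"
proof -
  obtain V where V: "\<And>t. t \<in> R \<Longrightarrow> open (V t) \<and> t \<in> V t \<and> avoids (ws, s) (R \<inter> V t) X" using loc by metis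
  then obtain \<sigma> where \<sigma>: "\<And>t u W x. t \<in> R \<Longrightarrow> u \<in> R \<inter> V t \<Longrightarrow> follows (\<sigma> t) X (length ws) W \<Longrightarrow>
     map W [0..<length ws] = ws \<Longrightarrow> map x [0..<length s] = s \<Longrightarrow> f x \<noteq> (u, W)"
    unfolding avoids_def prod.case by metis
  have "R \<subseteq> (\<Union>t\<in>R. V t)" using V by blast
  then obtain D where D: "D \<subseteq> R" "finite D" "R \<subseteq> (\<Union>t\<in>D. V t)"
    using compactE_image[OF assms(1), of R V] V by metis
  show ?thesis unfolding avoids_def prod.case
  proof (intro exI ballI allI impI)
    fix u W x assume u: "u \<in> R" and W: "follows (\<lambda>v. Max (insert 0 ((\<lambda>t. \<sigma> t v) ` D))) X (length ws) W"
      and e: "map W [0..<length ws] = ws" "map x [0..<length s] = s"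
    obtain t where t: "t \<in> D" "u \<in> V t" using D u by blast
    have "follows (\<sigma> t) X (length ws) W" by (rule follows_mono[OF W]) (use t D in auto)
    then show "f x \<noteq> (u, W)" using \<sigma>[of t u W x] t D u e by blast
  qed
qed

lemma perfect_set_dichotomy:
  "\<exists>P X. perf P \<and> X \<in> H \<and>
     ((\<exists>\<sigma>. \<forall>t\<in>P. \<forall>Y\<in>F_outcomes_I X \<sigma>. (t, Y) \<notin> range f) \<or>
      (\<forall>t\<in>P. \<exists>\<alpha>. strategy_II_G X \<alpha> \<and> G_outcomes_II X \<alpha> \<subseteq> {Y. (t, Y) \<in> range f}))"
proof (cases "\<exists>P X. perf P \<and> X \<in> H \<and> avoids ([], []) P X")
  case True
  then obtain P X where PX: "perf P" "X \<in> H" "avoids ([], []) P X" by blast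
  then obtain \<sigma> where \<sigma>: "\<And>t W x. t \<in> P \<Longrightarrow> follows \<sigma> X 0 W \<Longrightarrow> f x \<noteq> (t, W)"
    by (auto simp: avoids_def)
  have "\<forall>t\<in>P. \<forall>Y\<in>F_outcomes_I X \<sigma>. (t, Y) \<notin> range f"
    using \<sigma> by (fastforce simp: F_outcomes_I_def follows_def)
  then show ?thesis using PX by blast
next
  case False
  obtain X0 where X0: "X0 \<in> H" using H_nonempty by blast
  define I where "I = lists (Evec :: (nat \<Rightarrow> 'f) set) \<times> (UNIV :: nat list set)"
  have cI: "countable I" unfolding I_def by (intro countable_SIGMA countable_lists countable_Evec) simp
  have "\<exists>P1 X1. perf P1 \<and> P1 \<subseteq> {0..1} \<and> X1 \<in> H \<and> bpreceq X1 X0 \<and>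
    (\<forall>p\<in>I. \<forall>t\<in>P1. \<exists>V. open V \<and> t \<in> V \<and> (avoids p (P1 \<inter> V) X1 \<or> dead (avoids p) (P1 \<inter> V) X1))"
    by (rule decide_locally[OF cI avoids_mono perf_Icc X0]) simp_all
  then obtain P1 X1 where 1: "perf P1" "X1 \<in> H"
    and dec: "\<And>p t. p \<in> I \<Longrightarrow> t \<in> P1 \<Longrightarrow>
       \<exists>V. open V \<and> t \<in> V \<and> (avoids p (P1 \<inter> V) X1 \<or> dead (avoids p) (P1 \<inter> V) X1)"
    by metis
  \<comment> \<open>Open in \<open>t\<close> by construction; this makes \<open>target\<close> an
    admissible open target for \<open>open_game\<close>.\<close>
  define bad where "bad p t \<longleftrightarrow> (\<exists>V. open V \<and> t \<in> V \<and> dead (avoids p) (P1 \<inter> V) X1)" for p t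
  have bad: "\<not> avoids p (R \<inter> V) Z"
    if "bad p t" "perf R" "R \<subseteq> P1" "t \<in> R" "open V" "t \<in> V" "Z \<in> H" "bpreceq Z X1" for p t R V Z
  proof -
    note a = that
    obtain V' where V': "open V'" "t \<in> V'" "dead (avoids p) (P1 \<inter> V') X1" using a(1) unfolding bad_def by blast
    show ?thesis by (rule dead_locally[OF V'(3) avoids_subset a(2-4) V'(1,2) a(5-8)])
  qed
  \<comment> \<open>\<open>n < length ws\<close> forces at least one move, so a plan for it never
    starts as \<open>Done\<close>; \<open>j\<le>length ws\<close> bounds the admissible
    digits.\<close>
  define target where "target t s n ws \<longleftrightarrow> n < length ws \<and> (\<exists>j\<le>length ws. bad (ws, s @ [j]) t)" for t s n ws
  define K where "K p R Y \<longleftrightarrow> avoids p R Y \<or> (\<forall>t\<in>R. reach Y (target t (snd p) (length (fst p))) (fst p))" for p R Y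
  have "\<exists>P2 X2. perf P2 \<and> P2 \<subseteq> P1 \<and> X2 \<in> H \<and> bpreceq X2 X1 \<and>
    (\<forall>p\<in>I. \<forall>t\<in>P2. \<exists>V. open V \<and> t \<in> V \<and> K p (P2 \<inter> V) X2)"
  proof (rule fusion[OF cI _ _ 1])
    fix p R Y R' Y' assume "K p R Y" "R' \<subseteq> R" "Y \<in> H" "Y' \<in> H" "bpreceq_star Y' Y"
    then show "K p R' Y'" unfolding K_def using avoids_mono reach_mono H_block_seq by (meson subsetD)
  next
    fix p R Y assume p: "p \<in> I" and a: "perf R" "R \<subseteq> P1" "Y \<in> H" "bpreceq Y X1"
    obtain ws s where ws: "p = (ws, s)" "ws \<in> lists Evec" using p by (auto simp: I_def)
    have "\<exists>P Z. perf P \<and> P \<subseteq> R \<and> Z \<in> H \<and> bpreceq Z Y \<and>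
      ((\<forall>t\<in>P. reach Z (target t s (length ws)) ws) \<or>
       (\<exists>\<sigma>. \<forall>t\<in>P. \<forall>W. follows \<sigma> Z (length ws) W \<longrightarrow> map W [0..<length ws] = ws \<longrightarrow>
          (\<forall>k\<ge>length ws. \<not> target t s (length ws) (map W [0..<k]))))"
    proof (rule open_game[OF a(1,3) ws(2)])
      fix t v assume "target t s (length ws) v"
      then show "\<exists>V. open V \<and> t \<in> V \<and> (\<forall>u\<in>R \<inter> V. target u s (length ws) v)"
        unfolding target_def bad_def by blast
    qed
    then obtain P Z where PZ: "perf P" "P \<subseteq> R" "Z \<in> H" "bpreceq Z Y" and
      alt: "(\<forall>t\<in>P. reach Z (target t s (length ws)) ws) \<or>
       (\<exists>\<sigma>. \<forall>t\<in>P. \<forall>W. follows \<sigma> Z (length ws) W \<longrightarrow> map W [0..<length ws] = ws \<longrightarrow>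
          (\<forall>k\<ge>length ws. \<not> target t s (length ws) (map W [0..<k])))" by blast
    have "avoids (ws, s) P Z" if nr: "\<not> (\<forall>t\<in>P. reach Z (target t s (length ws)) ws)"
    proof -
      obtain \<sigma> where \<sigma>: "\<And>t W k. t \<in> P \<Longrightarrow> follows \<sigma> Z (length ws) W \<Longrightarrow> map W [0..<length ws] = ws \<Longrightarrow>
         length ws \<le> k \<Longrightarrow> \<not> target t s (length ws) (map W [0..<k])" using alt nr by blast
      \<comment> \<open>One strategy for each position and next digit. It is meaningful when the
        position is bad for no parameter in \<open>P\<close>: then local avoidance is glued by
        \<open>avoids_compact\<close>.\<close>
      define \<tau> where "\<tau> v j = (SOME \<tau>. \<forall>t\<in>P. \<forall>W x. follows \<tau> Z (length v) W \<longrightarrow>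
         map W [0..<length v] = v \<longrightarrow> map x [0..<length (s @ [j])] = s @ [j] \<longrightarrow> f x \<noteq> (t, W))" for v j
      have \<tau>: "f x \<noteq> (t, W)"
        if v: "v \<in> lists Evec" "\<forall>t\<in>P. \<not> bad (v, s @ [j]) t" and t: "t \<in> P" "follows (\<tau> v j) Z (length v) W"
          "map W [0..<length v] = v" "map x [0..<length (s @ [j])] = s @ [j]" for v j t W x
      proof -
        have "avoids (v, s @ [j]) P X1"
        proof (rule avoids_compact)
          show "compact P" using PZ by (simp add: perf_def)
          fix t assume t: "t \<in> P"
          have "(v, s @ [j]) \<in> I" "t \<in> P1" using v(1) t PZ(2) a(2) by (auto simp: I_def)
          from dec[OF this] obtain V where V: "open V" "t \<in> V" "avoids (v, s @ [j]) (P1 \<inter> V) X1"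
            using v(2) t unfolding bad_def by blast
          have "P \<inter> V \<subseteq> P1 \<inter> V" using PZ(2) a(2) by blast
          with V show "\<exists>V. open V \<and> t \<in> V \<and> avoids (v, s @ [j]) (P \<inter> V) X1" using avoids_subset by blast
        qed
        then have "avoids (v, s @ [j]) P Z"
          by (rule avoids_mono[OF _ subset_refl 1(2) PZ(3)])
            (use PZ a bpreceq_trans bpreceq_imp_star H_block_seq in blast)
        then have "\<forall>t\<in>P. \<forall>W x. follows (\<tau> v j) Z (length v) W \<longrightarrow>
           map W [0..<length v] = v \<longrightarrow> map x [0..<length (s @ [j])] = s @ [j] \<longrightarrow> f x \<noteq> (t, W)"
          unfolding \<tau>_def avoids_def prod.case by (rule someI_ex)
        then show ?thesis using t by blast
      qed
      \<comment> \<open>At \<open>v\<close>, I obeys \<open>\<sigma>\<close> and the strategies of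
        all initial segments \<open>take i v\<close> and digits \<open>j\<le>length v\<close>, which
        are finitely many.\<close>
      define \<rho> where "\<rho> v = Max (insert (\<sigma> v) ((\<lambda>(i, j). \<tau> (take i v) j v) ` ({..length v} \<times> {..length v})))" for v
      have \<rho>: "\<sigma> v \<le> \<rho> v" "\<And>i j. i \<le> length v \<Longrightarrow> j \<le> length v \<Longrightarrow> \<tau> (take i v) j v \<le> \<rho> v" for v
        unfolding \<rho>_def by (rule Max_ge; force)+
      show ?thesis unfolding avoids_def prod.case
      proof (intro exI ballI allI impI)
        fix t W x assume t: "t \<in> P" and W: "follows \<rho> Z (length ws) W" "map W [0..<length ws] = ws"
          and x: "map x [0..<length s] = s"
        define j where "j = x (length s)"
        \<comment> \<open>From length \<open>k\<close> on the digit \<open>j\<close> is admissible.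
          As \<open>\<sigma>\<close> misses the target, the position of length \<open>k\<close> is
          not bad for \<open>j\<close>, and from there on \<open>\<rho>\<close> dominates the
          strategy attached to it.\<close>
        define k where "k = max j (Suc (length ws))"
        let ?v = "map W [0..<k]"
        have "follows \<sigma> Z (length ws) W" by (rule follows_mono[OF W(1)]) (use \<rho> in auto)
        then have "\<not> target u s (length ws) ?v" if "u \<in> P" for u using \<sigma>[OF that _ W(2), of k] by (simp add: k_def)
        then have nb: "\<forall>u\<in>P. \<not> bad (?v, s @ [j]) u" by (force simp: target_def k_def)
        have ev: "?v \<in> lists Evec" using W(1) by (auto simp: follows_def block_seq_def)
        have "follows (\<tau> ?v j) Z (length ?v) W"
        proof (rule follows_mono[OF W(1)])
          fix m assume m: "length ?v \<le> m"
          then have "take k (map W [0..<m]) = ?v" by (simp add: take_map)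
          then show "\<tau> ?v j (map W [0..<m]) \<le> \<rho> (map W [0..<m])"
            using \<rho>(2)[of k "map W [0..<m]" j] m by (simp add: k_def)
        qed (simp add: k_def)
        then show "f x \<noteq> (t, W)" by (rule \<tau>[OF ev nb t]) (use x in \<open>simp_all add: j_def\<close>)
      qed
    qed
    then have "K p P Z" by (auto simp: K_def ws)
    then show "\<exists>R' Y'. perf R' \<and> R' \<subseteq> R \<and> Y' \<in> H \<and> bpreceq Y' Y \<and> K p R' Y'" using PZ by blast
  qed
  then obtain P2 X2 where 2: "perf P2" "P2 \<subseteq> P1" "X2 \<in> H" "bpreceq X2 X1"
    and K: "\<And>p t. p \<in> I \<Longrightarrow> t \<in> P2 \<Longrightarrow> \<exists>V. open V \<and> t \<in> V \<and> K p (P2 \<inter> V) X2"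
    by metis
  have reach: "reach X2 (target t s (length ws)) ws" if a: "t \<in> P2" "ws \<in> lists Evec" "bad (ws, s) t" for t ws s
  proof -
    have "(ws, s) \<in> I" using a by (simp add: I_def)
    then obtain V where V: "open V" "t \<in> V" "K (ws, s) (P2 \<inter> V) X2" using K a(1) by blast
    then show ?thesis using bad[OF a(3) 2(1,2) a(1) V(1,2) 2(3,4)] a(1) by (auto simp: K_def)
  qed
  \<comment> \<open>If the image had no such point, every strategy of I would witness
    \<open>avoids\<close> on the ball.\<close>
  have approx: "\<exists>x t' W. map x [0..<length s] = s \<and> map W [0..<length ws] = ws \<and> dist t' t < e \<and> f x = (t', W)"
    if "bad (ws, s) t" "t \<in> P2" "e > 0" for ws s t e
  proof (rule ccontr)
    assume "\<not> ?thesis"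
    then have "avoids (ws, s) (P2 \<inter> ball t e) X2" by (auto simp: avoids_def dist_commute)
    then show False using bad[OF that(1) 2(1,2) that(2) open_ball _ 2(3,4)] that(3) by simp
  qed
  have "\<exists>\<alpha>. strategy_II_G X2 \<alpha> \<and> G_outcomes_II X2 \<alpha> \<subseteq> {Y. (t, Y) \<in> range f}" if t: "t \<in> P2" for t
  proof -
    \<comment> \<open>\<open>Done\<close> is excluded: when a plan ends, the same move appends the
      new digit and starts a plan for it.\<close>
    define Inv where "Inv S \<longleftrightarrow> (case S of (ws, s, p) \<Rightarrow> ws \<in> lists Evec \<and> p \<noteq> Done \<and>
        (\<exists>n. winning X2 (target t s n) p ws))" for S
    define step where "step S z S' \<longleftrightarrow> (case S of (ws, s, p) \<Rightarrow> case S' of (ws', s', p') \<Rightarrow>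
       ws' = ws @ [z] \<and> ((s' = s \<and> (\<exists>F Z. p = Step F \<and> p' = snd (F Z))) \<or> (\<exists>j. s' = s @ [j] \<and> bad (ws', s') t)))"
      for S S' :: "(nat \<Rightarrow> 'f) list \<times> nat list \<times> 'f plan" and z
    have start: "\<exists>p. Inv (ws, s, p)" if a: "ws \<in> lists Evec" "bad (ws, s) t" for ws s
    proof -
      obtain p where p: "winning X2 (target t s (length ws)) p ws" using reach_imp_winning[OF reach[OF t a]] by blast
      then have "p \<noteq> Done" by (auto simp: target_def elim: winning.cases)
      then show ?thesis using p a by (auto simp: Inv_def)
    qed
    have "bad ([], []) t"
    proof -
      have "([], []) \<in> I" by (simp add: I_def)
      moreover have "dead (avoids ([], [])) R Y" for R Y using False by (auto simp: dead_def)
      ultimately show ?thesis unfolding bad_def by (intro exI[of _ UNIV]) simp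
    qed
    then obtain p0 where p0: "Inv ([], [], p0)" using start by blast
    obtain \<alpha> where \<alpha>: "strategy_II_G X2 \<alpha>"
      "\<And>Y. Y \<in> G_outcomes_II X2 \<alpha> \<Longrightarrow> \<exists>S. S 0 = ([], [], p0) \<and> (\<forall>k. Inv (S k) \<and> step (S k) (Y k) (S (Suc k)))"
    proof (rule state_machine_strategy[where Inv = Inv and step = step and X = X2, OF p0])
      fix S Z assume S: "Inv S" and Z: "block_seq Z" "bpreceq Z X2"
      obtain ws s p where Seq: "S = (ws, s, p)" by (metis prod_cases3)
      obtain n F where F: "p = Step F" "winning X2 (target t s n) (Step F) ws" and ws: "ws \<in> lists Evec"
        using S by (cases p) (auto simp: Inv_def Seq)
      have "fst (F Z) \<in> span_of Z \<and> fst (F Z) \<noteq> 0 \<and> winning X2 (target t s n) (snd (F Z)) (ws @ [fst (F Z)])"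
        using F(2) Z by (auto elim: winning.cases)
      then have z: "fst (F Z) \<in> span_of Z" "fst (F Z) \<noteq> 0" and w: "winning X2 (target t s n) (snd (F Z)) (ws @ [fst (F Z)])"
        by auto
      have ws': "ws @ [fst (F Z)] \<in> lists Evec" using ws z(1) span_of_subset_Evec[OF Z(1)] by auto
      have "\<exists>S'. Inv S' \<and> step S (fst (F Z)) S'"
      proof (cases "snd (F Z) = Done")
        case True
        then have "target t s n (ws @ [fst (F Z)])" using w by (auto elim: winning.cases)
        then obtain j where j: "bad (ws @ [fst (F Z)], s @ [j]) t" by (auto simp: target_def)
        then obtain p' where "Inv (ws @ [fst (F Z)], s @ [j], p')" using start[OF ws'] by blast
        moreover have "step S (fst (F Z)) (ws @ [fst (F Z)], s @ [j], p')" using j by (auto simp: step_def Seq)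
        ultimately show ?thesis by blast
      next
        case no: False
        have "Inv (ws @ [fst (F Z)], s, snd (F Z))" using w no ws' by (auto simp: Inv_def)
        moreover have "step S (fst (F Z)) (ws @ [fst (F Z)], s, snd (F Z))" using F by (auto simp: step_def Seq)
        ultimately show ?thesis by blast
      qed
      then show "\<exists>z\<in>span_of Z. z \<noteq> 0 \<and> (\<exists>S'. Inv S' \<and> step S z S')" using z by blast
    qed (use that in blast)
    have "(t, Y) \<in> range f" if Y: "Y \<in> G_outcomes_II X2 \<alpha>" for Y
    proof -
      obtain S where S0: "S 0 = ([], [], p0)" and S: "\<And>k. step (S k) (Y k) (S (Suc k))" using \<alpha>(2)[OF Y] by blast
      define w s p where "w k = fst (S k)" and "s k = fst (snd (S k))" and "p k = snd (snd (S k))" for k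
      have "w (Suc k) = w k @ [Y k]" for k
        using S[of k] by (auto simp: w_def step_def split: prod.splits)
      then have w: "w k = map Y [0..<k]" for k
        by (induct k) (simp_all add: w_def S0)
      have alt: "(s (Suc k) = s k \<and> (\<exists>F Z. p k = Step F \<and> p (Suc k) = snd (F Z))) \<or>
         (\<exists>j. s (Suc k) = s k @ [j] \<and> bad (w (Suc k), s (Suc k)) t)" for k
        using S[of k] by (auto simp: step_def w_def s_def p_def split: prod.splits)
      have progress: "\<exists>m>k. length (s k) < length (s m) \<and> bad (w m, s m) t" for k
      proof -
        \<comment> \<open>Until a digit is added each move passes to a proper subtree of the plan,
          so induction on the plan bounds the wait.\<close>
        have "p k = q \<Longrightarrow> \<exists>m>k. length (s k) < length (s m) \<and> bad (w m, s m) t" for q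
        proof (induct q arbitrary: k)
          case Done
          then have "length (s k) < length (s (Suc k)) \<and> bad (w (Suc k), s (Suc k)) t" using alt[of k] by auto
          then show ?case by blast
        next
          case (Step F)
          show ?case
          proof (cases "s (Suc k) = s k \<and> (\<exists>F Z. p k = plan.Step F \<and> p (Suc k) = snd (F Z))")
            case True
            then obtain Z where "p (Suc k) = snd (F Z)" using Step(2) by auto
            then obtain m where "m > Suc k" "length (s (Suc k)) < length (s m) \<and> bad (w m, s m) t"
              using Step(1)[of "F Z" "snd (F Z)" "Suc k"] by (auto simp: snds.intros)
            with True show ?thesis by (intro exI[of _ m]) auto
          next
            case no: False
            then have "length (s k) < length (s (Suc k)) \<and> bad (w (Suc k), s (Suc k)) t" using alt[of k] by auto
            then show ?thesis by blast
          qed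
        qed
        then show ?thesis by blast
      qed
      have far: "\<exists>m\<ge>N. N \<le> length (s m) \<and> bad (w m, s m) t" for N
      proof (induct N)
        case 0
        then show ?case using progress[of 0] by auto
      next
        case (Suc N)
        then obtain m where "N \<le> m" "N \<le> length (s m)" by blast
        then show ?case using progress[of m] by (metis Suc_leI le_less_trans)
      qed
      have pre: "take (length (s k)) (s m) = s k" if "k \<le> m" for k m
        using that
      proof (induct m rule: dec_induct)
        case (step m)
        have "length (s k) \<le> length (s m)" using arg_cong[OF step(3), of length] by simp
        then show ?case using alt[of m] step(3) by auto
      qed simp
      \<comment> \<open>Any stage with more than \<open>n\<close> digits gives the same value, since
        by \<open>pre\<close> the digit sequences extend each other.\<close>
      define x where "x n = s (SOME m. n < length (s m)) ! n" for n
      have x: "x n = s m ! n" if n: "n < length (s m)" for n m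
      proof -
        let ?m = "SOME m. n < length (s m)"
        have m: "n < length (s ?m)" by (rule someI[of _ m]) (rule n)
        show ?thesis
        proof (cases "?m \<le> m")
          case True
          then show ?thesis unfolding x_def using pre[OF True] m nth_take[OF m, of "s m"] by simp
        next
          case False
          then have "m \<le> ?m" by simp
          then show ?thesis unfolding x_def using pre[OF \<open>m \<le> ?m\<close>] n nth_take[OF n, of "s ?m"] by simp
        qed
      qed
      have "f x = (t, Y)"
      proof (rule limit_point)
        fix n and e :: real assume e: "e > 0"
        obtain m where m: "n \<le> m" "n \<le> length (s m)" "bad (w m, s m) t" using far by blast
        obtain x' t' W where x': "map x' [0..<length (s m)] = s m" "map W [0..<length (w m)] = w m"
          "dist t' t < e" "f x' = (t', W)" using approx[OF m(3) t e] by blast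
        have "x' i = x i" if "i < n" for i
          using that m x[of i m] arg_cong[OF x'(1), of "\<lambda>l. l ! i"] by simp
        moreover have "W i = Y i" if "i < n" for i
          using that m arg_cong[OF x'(2), of "\<lambda>l. l ! i"] by (simp add: w)
        ultimately show "\<exists>x'. map x' [0..<n] = map x [0..<n] \<and> dist (fst (f x')) t < e \<and> map (snd (f x')) [0..<n] = map Y [0..<n]"
          using x' by (intro exI[of _ x']) (auto simp: map_eq_conv)
      qed
      then show ?thesis by (metis rangeI)
    qed
    then show ?thesis using \<alpha>(1) by blast
  qed
  then show ?thesis using 2 by blast
qed

end

theorem theorem1p8:
  fixes H :: "(nat \<Rightarrow> nat \<Rightarrow> 'f::{field,countable}) set"
    and A :: "(real \<times> (nat \<Rightarrow> nat \<Rightarrow> 'f)) set"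
  assumes "strategic H" and "p_plus_family H"
    and "analytic_in (prod_topology euclideanreal Einf_top) A"
  shows "\<exists>P X. P \<noteq> {} \<and> perfect_set P \<and> X \<in> H \<and>
     ((\<exists>\<sigma>. \<forall>t\<in>P. \<forall>Y\<in>F_outcomes_I X \<sigma>. (t, Y) \<notin> A) \<or>
      (\<forall>t\<in>P. \<exists>\<alpha>. strategy_II_G X \<alpha> \<and> G_outcomes_II X \<alpha> \<subseteq> {Y. (t, Y) \<in> A}))"
proof -
  interpret strategic_p_plus H using assms(1,2) by unfold_locales
  show ?thesis
  \<comment> \<open>The empty set has no parametrisation by Baire space; here every strategy of I
    does.\<close>
  proof (cases "A = {}")
    case True
    obtain X where "X \<in> H" using H_nonempty by blast
    moreover have "perf {0..1}" by (rule perf_Icc) simp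
    ultimately show ?thesis using perf_imp_perfect_set True by blast
  next
    case False
    then obtain f where f: "continuous_map baire_top (prod_topology euclideanreal Einf_top) f" "range f = A"
      using assms(3) by (auto simp: analytic_in_def)
    interpret parametrised_analytic H f using f(1) by unfold_locales
    from perfect_set_dichotomy[unfolded f(2)] obtain P X where "perf P" "X \<in> H" and
      "(\<exists>\<sigma>. \<forall>t\<in>P. \<forall>Y\<in>F_outcomes_I X \<sigma>. (t, Y) \<notin> A) \<or>
       (\<forall>t\<in>P. \<exists>\<alpha>. strategy_II_G X \<alpha> \<and> G_outcomes_II X \<alpha> \<subseteq> {Y. (t, Y) \<in> A})"
      by (elim exE conjE) (rule that)
    then show ?thesis using perf_imp_perfect_set[OF \<open>perf P\<close>] by (intro exI[of _ P] exI[of _ X]) simp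
  qed
qed

end
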